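(* Let $L$ be a lattice of rank $2$ and let $\sigma\subset L_{\mathbf{R}}$ be a closed strictly convex 2-dimensional cone with ordered edges $l_-,l_+$ (not necessarily rational). Let $\sigma'$ be the supplementary cone bounded by $l_+$ and the half-line $l_-'$ opposite to $l_-$, and let $\mathcal{I}:\mathcal{E}(\sigma)\to\sigma'\cap L$ be the map which sends an edge $e$ of $P(\sigma)$ to the integral point $\mathcal{I}(e)$ such that $O\mathcal{I}(e)$ is the primitive vector of $L$ positively parallel to the oriented edge $e$. Then: (i) The map $\mathcal{I}$ respects the orientations (the points $\mathcal{I}(e)$ appear along the oriented line $P(\sigma')$ in the same order as the edges $e$ along the oriented line $P(\sigma)$), and its image satisfies $$\mathcal{V}(\sigma')\subset \mathrm{Im}(\mathcal{I})\subset P(\sigma')\cap L .$$ (ii) The difference $\mathrm{Im}(\mathcal{I})-\mathcal{V}(\sigma')$ contains at most the points $\mathcal{I}[A_-V_-]$ and $\mathcal{I}[V_+A_+]$. Such a point is a vertex of $P(\sigma')$ if and only if the integral length of the corresponding edge of $P(\sigma)$ is $\geq 2$. (iii) In particular, one has the equality $\mathcal{V}(\sigma')=\mathrm{Im}(\mathcal{I})$ if and only if $l_{\mathbf{Z}}[A_-V_-]\ge2$ and $l_{\mathbf{Z}}[V_+A_+]\ge2$, whenever these segments exist.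
   Context: $L$ is a free abelian group of rank 2, $L_{\mathbf{R}}=L\otimes_{\mathbf{Z}}\mathbf{R}$, $O$ is the origin; elements of $L$ are called integral points. A half-line from $O$ is rational if it contains an integral point other than $O$. The integral length $l_{\mathbf{Z}}[AB]$ of a segment with integral endpoints is the number of subsegments into which it is divided by the integral points it contains; a vector $OA\in L$ is primitive if $l_{\mathbf{Z}}[OA]=1$. For a closed strictly convex 2-dimensional cone $\sigma$ (the convex angle delimited by two distinct non-opposite half-lines from $O$, its edges), $K(\sigma)$ is the convex hull of $\sigma\cap(L-\{0\})$ and $P(\sigma)$ is its boundary, a connected polygonal line with two ends, each asymptotic to, or contained in, an edge of $\sigma$. $\mathcal{V}(\sigma)$ is the set of vertices of $P(\sigma)$ and $\mathcal{E}(\sigma)$ the set of its closed edges; these include, for each rational edge of $\sigma$, the unbounded edge of $P(\sigma)$ contained in it. $P(\sigma)$ and its edges are oriented from the end near $l_-$ to the end near $l_+$; likewise $P(\sigma')$ is oriented from the end near $l_-'$ to the end near $l_+$. It is a fact that $\mathcal{I}(e)\in\sigma'$ for each edge $e$. If $l_-$ is rational, $A_-$ is the nonzero integral point of $l_-$ nearest to $O$ and $V_-\ne A_-$ is the vertex of $P(\sigma)$ nearest to $A_-$, so that $[A_-V_-]$ is an edge of $P(\sigma)$. If $l_+$ is rational, $A_+$ and $V_+$ are defined in the same way. The segment $[A_-V_-]$ (resp. $[V_+A_+]$) exists only when $l_-$ (resp. $l_+$) is rational.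
   Formalization: If both edges of σ are rational and P(σ) has one bounded edge [A₋A₊], the claim fails for integral length 1 or 2: at length 1, Im(I)⊂P(σ') and the order claim are dropped; at length 2, the vertex criterion in (ii) and (iii) are dropped. *)

theory Defs
  imports "HOL-Analysis.Analysis"
begin

text \<open>
  The plane \<open>L\<^bsub>R\<^esub>\<close> is an arbitrary Euclidean space of dimension 2 and \<open>L\<close> is the integral span
  of one of its bases. The Euclidean structure is auxiliary: it is used only to speak of closeness,
  in ways that do not depend on its choice.
\<close>

definition planar_lattice :: "'a::euclidean_space set \<Rightarrow> bool" where
  "planar_lattice L \<longleftrightarrow>
     DIM('a) = 2 \<and>
     (\<exists>b c. b \<noteq> c \<and> independent {b, c} \<and>
        L = {of_int m *\<^sub>R b + of_int n *\<^sub>R c | m n. True})"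

definition half_line :: "'a::euclidean_space set \<Rightarrow> bool" where
  "half_line l \<longleftrightarrow> (\<exists>u. u \<noteq> 0 \<and> l = {t *\<^sub>R u | t. 0 \<le> t})"

definition rational :: "'a::euclidean_space set \<Rightarrow> 'a set \<Rightarrow> bool" where
  "rational L l \<longleftrightarrow> (\<exists>x\<in>L. x \<in> l \<and> x \<noteq> 0)"

text \<open>Number of pieces into which a segment with integral endpoints is cut by its integral points.\<close>

definition int_length :: "'a::euclidean_space set \<Rightarrow> 'a set \<Rightarrow> nat" where
  "int_length L s = card (s \<inter> L) - 1"

definition primitive :: "'a::euclidean_space set \<Rightarrow> 'a \<Rightarrow> bool" where
  "primitive L x \<longleftrightarrow> x \<in> L \<and> int_length L (closed_segment 0 x) = 1"

definition angle :: "'a::euclidean_space set \<Rightarrow> 'a set \<Rightarrow> 'a set" where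
  "angle l l' = convex hull (l \<union> l')"

definition opposite :: "'a::euclidean_space set \<Rightarrow> 'a set" where
  "opposite l = uminus ` l"

definition K :: "'a::euclidean_space set \<Rightarrow> 'a set \<Rightarrow> 'a set" where
  "K L \<sigma> = convex hull (\<sigma> \<inter> (L - {0}))"

definition P :: "'a::euclidean_space set \<Rightarrow> 'a set \<Rightarrow> 'a set" where
  "P L \<sigma> = frontier (K L \<sigma>)"

definition vertices :: "'a::euclidean_space set \<Rightarrow> 'a set \<Rightarrow> 'a set" where
  "vertices L \<sigma> = {x. x extreme_point_of K L \<sigma>}"

text \<open>Bounded and unbounded edges: all the one-dimensional faces of \<open>K L \<sigma>\<close>.\<close>

definition edges :: "'a::euclidean_space set \<Rightarrow> 'a set \<Rightarrow> 'a set set" where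
  "edges L \<sigma> = {e. e edge_of K L \<sigma>}"

text \<open>
  The orientation of \<open>P L (angle l l')\<close> from the end near \<open>l\<close> to the end near \<open>l'\<close>, given by
  injective parametrisations of the whole line; ``near'' covers both an end contained in an edge
  of the angle and an end asymptotic to it.
\<close>

definition oriented_parametrisation ::
    "'a::euclidean_space set \<Rightarrow> 'a set \<Rightarrow> 'a set \<Rightarrow> (real \<Rightarrow> 'a) \<Rightarrow> bool" where
  "oriented_parametrisation L l l' \<gamma> \<longleftrightarrow>
     continuous_on UNIV \<gamma> \<and> inj \<gamma> \<and> range \<gamma> = P L (angle l l') \<and>
     ((\<lambda>t. infdist (\<gamma> t) l) \<longlongrightarrow> 0) at_bot \<and>
     ((\<lambda>t. infdist (\<gamma> t) l') \<longlongrightarrow> 0) at_top"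

text \<open>\<open>A\<close> and \<open>B\<close> lie on \<open>P L (angle l l')\<close>, and \<open>A\<close> comes strictly before \<open>B\<close>.\<close>

definition before ::
    "'a::euclidean_space set \<Rightarrow> 'a set \<Rightarrow> 'a set \<Rightarrow> 'a \<Rightarrow> 'a \<Rightarrow> bool" where
  "before L l l' A B \<longleftrightarrow>
     (\<exists>\<gamma>. oriented_parametrisation L l l' \<gamma> \<and> (\<exists>s t. s < t \<and> \<gamma> s = A \<and> \<gamma> t = B))"

text \<open>Consecutive edges share an endpoint.\<close>

definition edge_before ::
    "'a::euclidean_space set \<Rightarrow> 'a set \<Rightarrow> 'a set \<Rightarrow> 'a set \<Rightarrow> 'a set \<Rightarrow> bool" where
  "edge_before L l l' e e' \<longleftrightarrow>
     e \<noteq> e' \<and> (\<forall>A\<in>e. \<forall>B\<in>e'. A = B \<or> before L l l' A B)"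

definition edge_vector ::
    "'a::euclidean_space set \<Rightarrow> 'a set \<Rightarrow> 'a set \<Rightarrow> 'a set \<Rightarrow> 'a" where
  "edge_vector L l l' e =
     (THE w. primitive L w \<and>
        (\<forall>A\<in>e. \<forall>B\<in>e. before L l l' A B \<longrightarrow> (\<exists>c>0. B - A = c *\<^sub>R w)))"

text \<open>
  For a rational edge \<open>l\<close> of \<open>\<sigma>\<close>, \<open>end_point L l\<close> is \<open>A\<^sub>-\<close> (resp. \<open>A\<^sub>+\<close>), \<open>end_vertex L \<sigma> l\<close> is
  \<open>V\<^sub>-\<close> (resp. \<open>V\<^sub>+\<close>), the vertex next to it along \<open>P L \<sigma>\<close>, and \<open>end_edge L \<sigma> l\<close> is the edge
  joining them. They are meaningless when \<open>l\<close> is not rational.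
\<close>

definition end_point :: "'a::euclidean_space set \<Rightarrow> 'a set \<Rightarrow> 'a" where
  "end_point L l =
     (THE A. A \<in> l \<inter> L - {0} \<and> (\<forall>B \<in> l \<inter> L - {0}. norm A \<le> norm B))"

definition end_vertex :: "'a::euclidean_space set \<Rightarrow> 'a set \<Rightarrow> 'a set \<Rightarrow> 'a" where
  "end_vertex L \<sigma> l =
     (THE V. V \<in> vertices L \<sigma> \<and> V \<noteq> end_point L l \<and>
             closed_segment (end_point L l) V \<in> edges L \<sigma>)"

definition end_edge :: "'a::euclidean_space set \<Rightarrow> 'a set \<Rightarrow> 'a set \<Rightarrow> 'a set" where
  "end_edge L \<sigma> l = closed_segment (end_point L l) (end_vertex L \<sigma> l)"

text \<open>
  \<open>single_edge L l l' n\<close>: both edges of the angle are rational and \<open>P\<close> has a single bounded edge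
  \<open>[A\<^sub>-A\<^sub>+]\<close>, of integral length \<open>n\<close>. The cases \<open>n = 1\<close> and \<open>n = 2\<close> are genuine exceptions. With
  \<open>L = \<int>\<^sup>2\<close>:

  \<^item> \<open>n = 1\<close>: for \<open>A\<^sub>- = (1, 0)\<close> and \<open>A\<^sub>+ = (0, 1)\<close>, the edge \<open>[A\<^sub>-A\<^sub>+]\<close> is sent to \<open>(-1, 1)\<close>, which
    is interior to \<open>K L \<sigma>'\<close>, since \<open>P L \<sigma>'\<close> consists of \<open>[(-1, 0), (0, 1)]\<close> and two half-lines.

  \<^item> \<open>n = 2\<close>: for \<open>A\<^sub>- = (0, 1)\<close> and \<open>A\<^sub>+ = (2, 1)\<close>, the edge \<open>[A\<^sub>-A\<^sub>+]\<close> is sent to \<open>(1, 0)\<close>, the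
    midpoint of the edge \<open>[(0, -1), (2, 1)]\<close> of \<open>P L \<sigma>'\<close>, hence not a vertex although the
    integral length is 2.
\<close>

definition single_edge ::
    "'a::euclidean_space set \<Rightarrow> 'a set \<Rightarrow> 'a set \<Rightarrow> nat \<Rightarrow> bool" where
  "single_edge L l l' n \<longleftrightarrow>
     rational L l \<and> rational L l' \<and>
     end_edge L (angle l l') l = end_edge L (angle l l') l' \<and>
     int_length L (end_edge L (angle l l') l) = n"

end

theory Submission
  imports Defs
begin

text \<open>
  Fix the alternating form \<open>\<omega>\<close> of determinant 1 on \<open>L\<close> with \<open>\<omega> u v > 0\<close>, where \<open>u\<close>, \<open>v\<close> span the
  edges of \<open>\<sigma>\<close>. Then \<open>\<omega>\<close> puts \<open>\<sigma>\<close> and \<open>\<sigma>'\<close> in duality: \<open>\<sigma>'\<close> consists of the \<open>p\<close> with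
  \<open>\<omega> x p \<ge> 0\<close> for all \<open>x\<close> in \<open>\<sigma>\<close>. An edge of \<open>P(\<sigma>)\<close> with primitive direction \<open>w\<close> lies on a line
  \<open>\<omega> x w = d\<close> with \<open>d \<in> {0, 1}\<close>, because a triangle \<open>O\<close>, \<open>A\<close>, \<open>A + w\<close> without further lattice
  points is unimodular; \<open>d = 0\<close> holds exactly for the unbounded edges.

  If \<open>A\<close> and \<open>A + w\<close> are lattice points of an edge and both are interior to \<open>\<sigma>\<close>, then \<open>\<omega> A\<close> and
  \<open>\<omega> (A + w)\<close> are at least 1 on \<open>K(\<sigma>')\<close> and are both 1 only at \<open>w\<close>, so \<open>w\<close> is a vertex. Conversely,
  let \<open>A\<close> be the first lattice point of \<open>\<sigma>\<close> on \<open>\<omega> x w = 1\<close> and suppose \<open>A + w\<close> is not in \<open>\<sigma>\<close>. Then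
  \<open>A + w\<close> and \<open>w - A\<close> are in \<open>\<sigma>'\<close> and \<open>w\<close> is their midpoint, hence not a vertex. The same
  argument decides the end edges of length 1.

  Along \<open>P(\<sigma>)\<close> the position is measured by the linear form \<open>\<omega> (u + v)\<close>, which is injective on it;
  two edges \<open>e\<close>, \<open>e'\<close> and their images are then both ordered by the sign of \<open>\<omega> (I e) (I e')\<close>.
\<close>

section \<open>Auxiliary facts on segments, positive combinations and translates\<close>

lemma linear_min_open_segment:
  assumes x: "x \<in> open_segment a b" and f: "linear (f :: 'a::real_vector \<Rightarrow> real)"
    and "f x = m" "m \<le> f a" "m \<le> f b"
  shows "f a = m \<and> f b = m"
proof -
  obtain t where t: "0 < t" "t < 1" "x = (1 - t) *\<^sub>R a + t *\<^sub>R b" using x by (auto simp: in_segment)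
  have "f x = (1 - t) * f a + t * f b" unfolding t(3) by (simp add: linear_add [OF f] linear_scale [OF f])
  then have eq: "(1 - t) * (f a - m) + t * (f b - m) = 0"
    using assms(3) by (simp add: algebra_simps)
  have "0 \<le> (1 - t) * (f a - m)" "0 \<le> t * (f b - m)" using t assms by auto
  then have "(1 - t) * (f a - m) = 0" "t * (f b - m) = 0" using eq by linarith+
  then show ?thesis using t by auto
qed

lemma pos_combination:
  fixes a b s t :: real
  assumes "0 \<le> a" "0 \<le> b" "0 \<le> s" "0 \<le> t" "0 < a \<and> 0 < s \<or> 0 < b \<and> 0 < t"
  shows "0 < a * s + b * t"
  using assms by (meson add_nonneg_pos add_pos_nonneg mult_nonneg_nonneg mult_pos_pos)

lemma convex_translation_vimage: "convex S \<Longrightarrow> convex ((\<lambda>x. x + y) -` S)"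
proof -
  assume "convex S"
  moreover have "(\<lambda>x. x + y) -` S = (+) (- y) ` S"
    by (force simp: image_iff algebra_simps)
  ultimately show ?thesis by simp
qed

section \<open>Lattices with a unimodular form\<close>

text \<open>By \<open>expand\<close>, \<open>\<omega> x c\<close> and \<open>\<omega> b x\<close>
  are the coordinates of \<open>x\<close> in the basis \<open>b\<close>, \<open>c\<close>, so
  \<open>\<omega>\<close> is the determinant in that basis. The axioms survive a sign change of
  \<open>\<omega>\<close> together with an exchange of \<open>b\<close> and \<open>c\<close>; this
  later supplies the reflections of a cone.\<close>

locale unimodular_plane =
  fixes L :: "'a::euclidean_space set" and \<omega> :: "'a \<Rightarrow> 'a \<Rightarrow> real" and b c :: 'a
  assumes bilin: "bounded_bilinear \<omega>"
    and alt [simp]: "\<omega> x x = 0"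
    and unit: "\<omega> b c = 1"
    and expand: "x = \<omega> x c *\<^sub>R b + \<omega> b x *\<^sub>R c"
    and L_eq: "L = {of_int m *\<^sub>R b + of_int n *\<^sub>R c | m n. True}"
    and dim2: "DIM('a) = 2"
begin

lemmas om_simps [simp] =
  bounded_bilinear.add_left [OF bilin] bounded_bilinear.add_right [OF bilin]
  bounded_bilinear.diff_left [OF bilin] bounded_bilinear.diff_right [OF bilin]
  bounded_bilinear.minus_left [OF bilin] bounded_bilinear.minus_right [OF bilin]
  bounded_bilinear.zero_left [OF bilin] bounded_bilinear.zero_right [OF bilin]
  bounded_bilinear.scaleR_left [OF bilin] bounded_bilinear.scaleR_right [OF bilin]

lemma anti: "\<omega> y x = - \<omega> x y"
proof -
  have "\<omega> (x + y) (x + y) = 0" by (rule alt)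
  then show ?thesis by (simp del: alt) (simp add: alt)
qed

lemma om_coords: "\<omega> x y = \<omega> x c * \<omega> b y - \<omega> b x * \<omega> y c"
proof -
  have "\<omega> x y = \<omega> (\<omega> x c *\<^sub>R b + \<omega> b x *\<^sub>R c) (\<omega> y c *\<^sub>R b + \<omega> b y *\<^sub>R c)"
    by (rule arg_cong2 [where f = \<omega>, OF expand expand])
  also have "\<dots> = \<omega> x c * \<omega> b y - \<omega> b x * \<omega> y c"
    using anti [of c b] by (simp add: unit algebra_simps)
  finally show ?thesis .
qed

lemma vec_eqI: "\<omega> x c = \<omega> y c \<Longrightarrow> \<omega> b x = \<omega> b y \<Longrightarrow> x = y"
  by (subst expand [of x], subst expand [of y]) (rule arg_cong2 [of _ _ _ _ "(+)"], simp_all)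

lemma cramer: "\<omega> p q *\<^sub>R x = \<omega> x q *\<^sub>R p + \<omega> p x *\<^sub>R q"
  by (rule vec_eqI) (simp_all add: om_coords [of p q] om_coords [of x q] om_coords [of p x] algebra_simps)

text \<open>Pairing Cramer's rule with \<open>y\<close> gives the three-term Pluecker relation, the
  source of the sign comparisons for cones.\<close>

lemma plucker: "\<omega> p q * \<omega> x y = \<omega> x q * \<omega> p y + \<omega> p x * \<omega> q y"
  using arg_cong [OF cramer [of p q x], of "\<lambda>z. \<omega> z y"] by simp

lemma parallel:
  assumes "\<omega> x w = 0" "w \<noteq> 0"
  obtains t where "x = t *\<^sub>R w"
proof -
  obtain y where y: "\<omega> y w \<noteq> 0"
  proof (cases "\<omega> b w = 0")
    case True
    then have "\<omega> w c \<noteq> 0" using vec_eqI [of w 0] assms by auto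
    then have "\<omega> c w \<noteq> 0" using anti [of c w] by simp
    then show ?thesis using that by blast
  qed (use that in blast)
  have "\<omega> y w *\<^sub>R x = \<omega> y x *\<^sub>R w"
    using cramer [of y w x] assms by simp
  then have "(1 / \<omega> y w) *\<^sub>R \<omega> y w *\<^sub>R x = (1 / \<omega> y w) *\<^sub>R \<omega> y x *\<^sub>R w"
    by simp
  then have "x = (\<omega> y x / \<omega> y w) *\<^sub>R w"
    using y by simp
  then show ?thesis using that by blast
qed

lemma continuous_om [continuous_intros]:
  "continuous_on S f \<Longrightarrow> continuous_on S g \<Longrightarrow> continuous_on S (\<lambda>x. \<omega> (f x) (g x))"
  by (rule bounded_bilinear.continuous_on [OF bilin])

lemma linear_om_left: "linear (\<lambda>x. \<omega> x y)"
  by (rule linearI) simp_all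

lemma linear_om_right: "linear (\<omega> x)"
  by (rule linearI) simp_all

lemma L_iff: "x \<in> L \<longleftrightarrow> \<omega> x c \<in> \<int> \<and> \<omega> b x \<in> \<int>"
proof
  assume "x \<in> L"
  then obtain m n where "x = of_int m *\<^sub>R b + of_int n *\<^sub>R c" by (auto simp: L_eq)
  then show "\<omega> x c \<in> \<int> \<and> \<omega> b x \<in> \<int>" by (simp add: unit)
next
  assume "\<omega> x c \<in> \<int> \<and> \<omega> b x \<in> \<int>"
  then obtain m n where "\<omega> x c = of_int m" "\<omega> b x = of_int n" by (auto elim!: Ints_cases)
  then show "x \<in> L" using expand [of x] by (auto simp: L_eq)
qed

lemma L_zero [simp]: "0 \<in> L"
  and L_add: "x \<in> L \<Longrightarrow> y \<in> L \<Longrightarrow> x + y \<in> L"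
  and L_diff: "x \<in> L \<Longrightarrow> y \<in> L \<Longrightarrow> x - y \<in> L"
  and L_minus [simp]: "- x \<in> L \<longleftrightarrow> x \<in> L"
  and L_scale: "t \<in> \<int> \<Longrightarrow> x \<in> L \<Longrightarrow> t *\<^sub>R x \<in> L"
  by (auto simp: L_iff)

lemma L_om: "x \<in> L \<Longrightarrow> y \<in> L \<Longrightarrow> \<omega> x y \<in> \<int>"
  by (subst om_coords) (auto simp: L_iff)

lemma L_om_pos: "x \<in> L \<Longrightarrow> y \<in> L \<Longrightarrow> 0 < \<omega> x y \<Longrightarrow> 1 \<le> \<omega> x y"
  using L_om by (fastforce elim!: Ints_cases)

text \<open>This is unimodularity: \<open>w\<close> is part of a basis of \<open>L\<close>. The
  proofs work with the partner \<open>x\<close>; agreement with \<open>primitive\<close> is shown in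
  \<open>primitive_iff\<close>.\<close>

definition prim :: "'a \<Rightarrow> bool" where
  "prim w \<longleftrightarrow> w \<in> L \<and> (\<exists>x\<in>L. \<omega> x w = 1)"

lemma prim_nonzero: "prim w \<Longrightarrow> w \<noteq> 0"
  by (auto simp: prim_def)

lemma prim_minus: "prim w \<Longrightarrow> prim (- w)"
  by (force simp: prim_def intro: bexI [of _ "- _"])

lemma prim_scale_Ints: "prim w \<Longrightarrow> t *\<^sub>R w \<in> L \<Longrightarrow> t \<in> \<int>"
  using L_om [of _ "t *\<^sub>R w"] by (force simp: prim_def)

text \<open>Division by the gcd leaves coprime coordinates, and their Bezout coefficients yield the
  partner vector required by \<open>prim\<close>.\<close>

lemma prim_multiple:
  assumes "z \<in> L" "z \<noteq> 0"
  obtains w and k :: int where "prim w" "k \<ge> 1" "z = of_int k *\<^sub>R w"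
proof -
  obtain m n where z: "z = of_int m *\<^sub>R b + of_int n *\<^sub>R c" using assms by (auto simp: L_eq)
  define g where "g = gcd m n"
  have g: "g > 0" using assms z by (auto simp: g_def) 
  define w where "w = of_int (m div g) *\<^sub>R b + of_int (n div g) *\<^sub>R c"
  have mn: "m = g * (m div g)" "n = g * (n div g)" by (auto simp: g_def)
  have "z = of_int g *\<^sub>R w"
    unfolding z w_def by (subst mn(1), subst mn(2)) (simp add: scaleR_add_right)
  moreover obtain p q where pq: "p * m + q * n = g" using bezout_int [of m n] by (auto simp: g_def)
  have "g * (p * (m div g) + q * (n div g)) = g * 1"
    using mn pq by (metis distrib_left mult.left_commute mult.right_neutral)
  then have pq1: "p * (m div g) + q * (n div g) = 1" using g by simp
  have "w \<in> L" by (auto simp: L_eq w_def)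
  moreover have "of_int q *\<^sub>R b + of_int (- p) *\<^sub>R c \<in> L" unfolding L_eq by blast
  moreover have "\<omega> (of_int q *\<^sub>R b + of_int (- p) *\<^sub>R c) w = of_int (p * (m div g) + q * (n div g))"
    unfolding w_def using anti [of c b] by (simp add: unit algebra_simps)
  ultimately have "prim w" unfolding prim_def pq1 of_int_1 by blast
  then show ?thesis using that [of w g] \<open>z = of_int g *\<^sub>R w\<close> g by simp
qed

lemma prim_segment:
  assumes "prim w" shows "closed_segment 0 w \<inter> L = {0, w}"
proof
  show "closed_segment 0 w \<inter> L \<subseteq> {0, w}"
  proof
    fix x assume "x \<in> closed_segment 0 w \<inter> L"
    then obtain t where t: "0 \<le> t" "t \<le> 1" "x = t *\<^sub>R w" "x \<in> L" by (auto simp: in_segment)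
    then have "t \<in> \<int>" using prim_scale_Ints assms by blast
    then have "t = 0 \<or> t = 1" using t by (auto elim!: Ints_cases)
    then show "x \<in> {0, w}" using t by auto
  qed
qed (use assms in \<open>auto simp: prim_def\<close>)

lemma primitive_iff: "primitive L w \<longleftrightarrow> prim w"
proof
  assume "prim w"
  then show "primitive L w"
    using prim_segment [of w] prim_nonzero [of w]
    by (auto simp: primitive_def int_length_def prim_def card_insert_if)
next
  assume w: "primitive L w"
  then have wL: "w \<in> L" and c: "card (closed_segment 0 w \<inter> L) = 2"
    by (auto simp: primitive_def int_length_def)
  have "w \<noteq> 0" using c by (auto simp: card_insert_if)
  then obtain v k where v: "prim v" "k \<ge> 1" "w = of_int k *\<^sub>R v" using prim_multiple wL by metis
  have "v = (1 / of_int k) *\<^sub>R w" using v by simp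
  moreover have "1 / of_int k \<ge> (0::real)" "1 / of_int k \<le> (1::real)" using v by auto
  ultimately have "v \<in> closed_segment 0 w \<inter> L" using v(1)
    by (auto simp: in_segment prim_def intro!: exI [of _ "1 / of_int k"])
  \<comment> \<open>If \<open>v\<close> differed from \<open>w\<close>, the segment would contain
    three lattice points instead of two.\<close>
  then have "{0, w, v} \<subseteq> closed_segment 0 w \<inter> L" using wL by auto
  moreover have "finite (closed_segment 0 w \<inter> L)" using c by (intro card_ge_0_finite) simp
  ultimately have "card {0, w, v} \<le> 2" using c by (metis card_mono)
  moreover have "card {0, w, v} = 3" if "v \<noteq> w"
    using that \<open>w \<noteq> 0\<close> prim_nonzero [OF v(1)] by simp
  ultimately have "v = w" by linarith
  then show "prim w" using v by simp
qed

text \<open>Both \<open>t\<close> and \<open>1 / t\<close> are positive integers, hence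
  \<open>t = 1\<close>.\<close>

lemma prim_pos_multiple_eq:
  assumes "prim w" "prim w'" "w' = t *\<^sub>R w" "t > 0"
  shows "w' = w"
proof -
  have "t \<in> \<int>" using assms prim_scale_Ints by (metis prim_def)
  moreover have "1 / t \<in> \<int>"
    by (rule prim_scale_Ints [of w']) (use assms in \<open>auto simp: prim_def\<close>)
  ultimately have "t \<ge> 1" "1 / t \<ge> 1" using assms
    using Ints_nonzero_abs_ge1 [of t] Ints_nonzero_abs_ge1 [of "1 / t"] by auto
  then have "t = 1" using assms by (auto simp: field_simps)
  then show ?thesis using assms by simp
qed

lemma lattice_basis:
  assumes "\<omega> x w = 1" shows "y = \<omega> y w *\<^sub>R x + \<omega> x y *\<^sub>R w"
  using cramer [of x w y] assms by simp

lemma om_mult_bound: obtains M where "M > 0" "\<And>x y. \<bar>\<omega> x y\<bar> \<le> norm x * norm y * M"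
  using bounded_bilinear.pos_bounded [OF bilin] that by auto

section \<open>Approximation of vectors and lines by lattice points\<close>

lemma L_approx:
  obtains z where "\<And>n::nat. z n \<in> L" "(\<lambda>n. (1 / real n) *\<^sub>R z n) \<longlonglongrightarrow> s"
proof -
  \<comment> \<open>Rounding \<open>n s\<close> down costs less than 1 in each coordinate, which
    division by \<open>n\<close> makes negligible.\<close>
  define z where "z n = of_int \<lfloor>real n * \<omega> s c\<rfloor> *\<^sub>R b + of_int \<lfloor>real n * \<omega> b s\<rfloor> *\<^sub>R c" for n :: nat
  have lim: "(\<lambda>n. of_int \<lfloor>real n * t\<rfloor> / real n) \<longlonglongrightarrow> t" for t :: real
  proof (rule tendsto_sandwich [of "\<lambda>n. t - 1 / real n" _ _ "\<lambda>n. t"])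
    have "eventually (\<lambda>n::nat. n > 0) sequentially" by (rule eventually_gt_at_top)
    then show "\<forall>\<^sub>F n in sequentially. t - 1 / real n \<le> of_int \<lfloor>real n * t\<rfloor> / real n"
    proof eventually_elim
      case (elim n)
      have "(real n * t - 1) / real n \<le> of_int \<lfloor>real n * t\<rfloor> / real n"
        by (intro divide_right_mono) linarith+
      then show ?case using elim by (simp add: diff_divide_distrib)
    qed
    have "eventually (\<lambda>n::nat. n > 0) sequentially" by (rule eventually_gt_at_top)
    then show "\<forall>\<^sub>F n in sequentially. of_int \<lfloor>real n * t\<rfloor> / real n \<le> t"
    proof eventually_elim
      case (elim n)
      have "of_int \<lfloor>real n * t\<rfloor> \<le> real n * t" by linarith
      then show ?case using elim by (simp add: field_simps)
    qed
    show "(\<lambda>n. t - 1 / real n) \<longlonglongrightarrow> t" 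
      using tendsto_diff [OF tendsto_const lim_1_over_n, of t] by simp
  qed auto
  have "(\<lambda>n. (of_int \<lfloor>real n * \<omega> s c\<rfloor> / real n) *\<^sub>R b + (of_int \<lfloor>real n * \<omega> b s\<rfloor> / real n) *\<^sub>R c)
         \<longlonglongrightarrow> \<omega> s c *\<^sub>R b + \<omega> b s *\<^sub>R c"
    by (intro tendsto_intros lim)
  then have "(\<lambda>n. (1 / real n) *\<^sub>R z n) \<longlonglongrightarrow> s"
    using expand [of s] by (simp add: z_def scaleR_add_right)
  moreover have "z n \<in> L" for n unfolding z_def L_eq by blast
  ultimately show ?thesis using that by blast
qed

lemma L_near_line:
  assumes "\<epsilon> > 0" obtains z where "z \<in> L" "z \<noteq> 0" "\<bar>\<omega> u z\<bar> < \<epsilon>"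
proof (cases "\<omega> u c = 0")
  case True
  moreover have "c \<in> L" by (auto simp: L_iff unit)
  moreover have "c \<noteq> 0" using unit by auto
  ultimately show ?thesis using that assms by auto
next
  case False
  define u1 where "u1 = \<omega> u c"
  define u2 where "u2 = \<omega> b u"
  obtain N :: nat where N: "real N > \<bar>u1\<bar> / \<epsilon>" using reals_Archimedean2 by blast
  then have N0: "N > 0" using assms 
    by (cases N) (auto simp: field_simps)
  \<comment> \<open>Simultaneous Dirichlet approximation, applied to the single number
    \<open>u2 / u1\<close> with index 0.\<close>
  obtain q p where qp: "0 < q" "\<bar>of_int q * (u2 / u1) - of_int (p (0::nat))\<bar> < 1 / N"
    using Dirichlet_approx_simult [OF N0, of 1 "\<lambda>_. u2 / u1"] zero_less_one by metis
  define z where "z = of_int q *\<^sub>R b + of_int (p 0) *\<^sub>R c"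
  have "z \<in> L" unfolding z_def L_eq by blast
  moreover have "z \<noteq> 0"
  proof
    assume "z = 0"
    then have "\<omega> z c = 0" by simp
    then show False using qp by (simp add: z_def unit)
  qed
  moreover have "\<omega> u z = - (u1 * (of_int q * (u2 / u1) - of_int (p 0)))"
    using False anti [of b u] by (simp add: z_def u1_def u2_def field_simps)
  then have "\<bar>\<omega> u z\<bar> = \<bar>u1\<bar> * \<bar>of_int q * (u2 / u1) - of_int (p 0)\<bar>" by (simp add: abs_mult)
  moreover have "\<dots> < \<bar>u1\<bar> * (1 / N)" using qp(2) False by (intro mult_strict_left_mono) (auto simp: u1_def)
  moreover have "\<bar>u1\<bar> * (1 / N) < \<epsilon>" using N N0 assms by (simp add: field_simps)
  ultimately show ?thesis using that by auto
qed

lemma opposite_form: "unimodular_plane L (\<lambda>x y. - \<omega> x y) c b"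
proof (rule unimodular_plane.intro)
  show "bounded_bilinear (\<lambda>x y. - \<omega> x y)"
    unfolding bilinear_conv_bounded_bilinear [symmetric] bilinear_def by (auto intro!: linearI)
  show "- \<omega> c b = 1" using unit anti [of c b] by simp
  show "x = - \<omega> x b *\<^sub>R c + - \<omega> c x *\<^sub>R b" for x
    using expand [of x] anti [of x b] anti [of c x] by (simp add: add.commute)
  show "L = {of_int m *\<^sub>R c + of_int n *\<^sub>R b | m n. True}"
    unfolding L_eq by (metis (no_types, opaque_lifting) add.commute)
qed (use dim2 in auto)

end

section \<open>Cones and the convex hull of their lattice points\<close>

locale lattice_cone = unimodular_plane +
  fixes u v
  assumes D: "0 < \<omega> u v"
begin

text \<open>
  \<open>C\<close> is the cone \<open>\<sigma>\<close> spanned by \<open>u\<close> and \<open>v\<close>, \<open>Ci\<close> its interior, and \<open>C'\<close> the supplementary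
  cone \<open>\<sigma>'\<close> spanned by \<open>- u\<close> and \<open>v\<close>.
\<close>

definition C where "C = {x. 0 \<le> \<omega> u x \<and> 0 \<le> \<omega> x v}"
definition Ci where "Ci = {x. 0 < \<omega> u x \<and> 0 < \<omega> x v}"
definition C' where "C' = {p. 0 \<le> \<omega> u p \<and> 0 \<le> \<omega> v p}"

abbreviation "ru \<equiv> {t *\<^sub>R u | t. 0 \<le> t}"
abbreviation "rv \<equiv> {t *\<^sub>R v | t. 0 \<le> t}"

lemma cone_expand: "(\<omega> x v / \<omega> u v) *\<^sub>R u + (\<omega> u x / \<omega> u v) *\<^sub>R v = x"
proof -
  have "(1 / \<omega> u v) *\<^sub>R (\<omega> x v *\<^sub>R u + \<omega> u x *\<^sub>R v) = (1 / \<omega> u v) *\<^sub>R \<omega> u v *\<^sub>R x"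
    by (simp only: cramer [of u v x])
  then show ?thesis using D by (simp add: scaleR_add_right)
qed

lemma cone_eqI: "\<omega> u x = \<omega> u y \<Longrightarrow> \<omega> x v = \<omega> y v \<Longrightarrow> x = y"
  by (metis cone_expand)

lemma ru_iff: "x \<in> ru \<longleftrightarrow> \<omega> u x = 0 \<and> 0 \<le> \<omega> x v"
proof
  assume "x \<in> ru" then show "\<omega> u x = 0 \<and> 0 \<le> \<omega> x v" using D by auto
next
  assume "\<omega> u x = 0 \<and> 0 \<le> \<omega> x v"
  then have "(\<omega> x v / \<omega> u v) *\<^sub>R u = x" "0 \<le> \<omega> x v / \<omega> u v" using cone_expand [of x] D by auto
  then show "x \<in> ru" by (metis (mono_tags, lifting) mem_Collect_eq)
qed

lemma rv_iff: "x \<in> rv \<longleftrightarrow> \<omega> x v = 0 \<and> 0 \<le> \<omega> u x"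
proof
  assume "x \<in> rv" then show "\<omega> x v = 0 \<and> 0 \<le> \<omega> u x" using D by auto
next
  assume "\<omega> x v = 0 \<and> 0 \<le> \<omega> u x"
  then have "(\<omega> u x / \<omega> u v) *\<^sub>R v = x" "0 \<le> \<omega> u x / \<omega> u v" using cone_expand [of x] D by auto
  then show "x \<in> rv" by (metis (mono_tags, lifting) mem_Collect_eq)
qed

lemma C_add: "x \<in> C \<Longrightarrow> y \<in> C \<Longrightarrow> x + y \<in> C"
  and C_scale: "0 \<le> t \<Longrightarrow> x \<in> C \<Longrightarrow> t *\<^sub>R x \<in> C"
  and Ci_add: "x \<in> C \<Longrightarrow> y \<in> Ci \<Longrightarrow> x + y \<in> Ci"
  and Ci_scale: "0 < t \<Longrightarrow> x \<in> Ci \<Longrightarrow> t *\<^sub>R x \<in> Ci"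
  and Ci_subset: "Ci \<subseteq> C"
  by (auto simp: C_def Ci_def)

lemma convex_C: "convex C"
  unfolding convex_def by (intro ballI allI impI C_add C_scale) auto

lemma C_pointed: "x \<in> C \<Longrightarrow> y \<in> C \<Longrightarrow> x + y = 0 \<Longrightarrow> x = 0"
proof (rule cone_eqI)
  assume a: "x \<in> C" "y \<in> C" "x + y = 0"
  then have y: "y = - x" by (simp add: eq_neg_iff_add_eq_0 add.commute)
  show "\<omega> u x = \<omega> u 0" "\<omega> x v = \<omega> 0 v" using a y by (auto simp: C_def)
qed

lemma uv_Ci: "u + v \<in> Ci"
  using D by (auto simp: Ci_def)

lemma closed_C: "closed C"
  unfolding C_def by (intro closed_Collect_conj closed_Collect_le continuous_intros)

lemma open_Ci: "open Ci"
  unfolding Ci_def by (intro open_Collect_conj open_Collect_less continuous_intros)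

lemma angle_eq: "angle ru rv = C"
proof
  have "ru \<union> rv \<subseteq> C" using D by (auto simp: C_def)
  then show "angle ru rv \<subseteq> C"
    unfolding angle_def by (intro hull_minimal convex_C)
next
  show "C \<subseteq> angle ru rv"
  proof
    fix x assume x: "x \<in> C"
    \<comment> \<open>The factor 2 turns the sum of the two components of \<open>x\<close> into a
      midpoint.\<close>
    define p q where "p = (2 * (\<omega> x v / \<omega> u v)) *\<^sub>R u" and "q = (2 * (\<omega> u x / \<omega> u v)) *\<^sub>R v"
    have "p \<in> ru" "q \<in> rv" using x D unfolding ru_iff rv_iff by (simp_all add: p_def q_def C_def)
    then have pq: "p \<in> convex hull (ru \<union> rv)" "q \<in> convex hull (ru \<union> rv)"
      by (auto intro: hull_inc)
    have "(1/2) *\<^sub>R p + (1/2) *\<^sub>R q \<in> convex hull (ru \<union> rv)"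
      by (rule convexD [OF convex_convex_hull pq]) auto
    moreover have "(1/2) *\<^sub>R p + (1/2) *\<^sub>R q = x"
      using cone_expand [of x] by (simp add: p_def q_def)
    ultimately show "x \<in> angle ru rv" by (simp add: angle_def)
  qed
qed

definition G where "G = C \<inter> (L - {0})"

lemma K_eq: "K L C = convex hull G"
  by (simp add: K_def G_def)

lemma G_K: "x \<in> G \<Longrightarrow> x \<in> K L C"
  by (simp add: K_eq hull_inc)

lemma G_add: "x \<in> G \<Longrightarrow> y \<in> C \<Longrightarrow> y \<in> L \<Longrightarrow> x + y \<in> G"
  using C_pointed [of x y] by (auto simp: G_def C_add L_add)

lemma convex_K: "convex (K L C)" by (simp add: K_eq)

lemma K_minimal: "convex S \<Longrightarrow> (\<And>x. x \<in> G \<Longrightarrow> x \<in> S) \<Longrightarrow> K L C \<subseteq> S"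
  unfolding K_eq by (rule hull_minimal) auto

lemma K_subset_C: "K L C \<subseteq> C"
  by (rule K_minimal [OF convex_C]) (auto simp: G_def)

lemma closure_K_subset_C: "closure (K L C) \<subseteq> C"
  using closure_minimal [OF K_subset_C closed_C] .

lemma K_add_L:
  assumes "x \<in> K L C" "y \<in> C" "y \<in> L" shows "x + y \<in> K L C"
proof -
  have "K L C \<subseteq> (\<lambda>x. x + y) -` K L C"
  proof (rule K_minimal)
    show "convex ((\<lambda>x. x + y) -` K L C)"
      by (rule convex_translation_vimage [OF convex_K])
  qed (use assms G_add G_K in auto)
  then show ?thesis using assms by auto
qed

text \<open>The point lies between \<open>x\<close> and \<open>x + n y\<close> for an integer
  \<open>n \<ge> t\<close>.\<close>

lemma K_add_ray:
  assumes x: "x \<in> K L C" and y: "y \<in> C" "y \<in> L" and "0 \<le> t" shows "x + t *\<^sub>R y \<in> K L C"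
proof -
  obtain n :: nat where "real n > t" using reals_Archimedean2 by blast
  then have n: "real n \<ge> t" "n > 0" using assms(4) by (auto intro: gr0I)
  have "x + real n *\<^sub>R y \<in> K L C"
    by (rule K_add_L) (use x y in \<open>auto intro: C_scale L_scale\<close>)
  moreover have "x + t *\<^sub>R y = (1 - t / n) *\<^sub>R x + (t / n) *\<^sub>R (x + real n *\<^sub>R y)"
    using n by (simp add: algebra_simps)
  ultimately show ?thesis using n assms(4)
    by (simp only:) (rule convexD [OF convex_K], use x in auto)
qed

text \<open>\<open>s\<close> is a limit of points \<open>z n / n\<close> with \<open>z n\<close> in
  \<open>L\<close>. As \<open>Ci\<close> is open, \<open>z n\<close> eventually lies in the cone,
  and \<open>K_add_ray\<close> applies with factor \<open>1 / n\<close>.\<close>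

lemma closure_K_add_Ci:
  assumes "x \<in> closure (K L C)" "s \<in> Ci" shows "x + s \<in> closure (K L C)"
proof -
  obtain z where zL: "\<And>n::nat. z n \<in> L" and z: "(\<lambda>n. (1 / real n) *\<^sub>R z n) \<longlonglongrightarrow> s"
    using L_approx by blast
  obtain y where y: "\<And>n. y n \<in> K L C" "y \<longlonglongrightarrow> x"
    using assms(1) closure_sequential by blast
  have lim: "(\<lambda>n. y n + (1 / real n) *\<^sub>R z n) \<longlonglongrightarrow> x + s" using y z by (intro tendsto_intros)
  have "\<forall>\<^sub>F n in sequentially. (1 / real n) *\<^sub>R z n \<in> Ci"
    using topological_tendstoD [OF z open_Ci] assms(2) by blast
  then have "\<forall>\<^sub>F n in sequentially. y n + (1 / real n) *\<^sub>R z n \<in> K L C"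
    using eventually_gt_at_top [of 0]
  proof eventually_elim
    case (elim n)
    then have "real n *\<^sub>R (1 / real n) *\<^sub>R z n \<in> Ci" by (simp only: Ci_scale of_nat_0_less_iff)
    moreover have "real n *\<^sub>R (1 / real n) *\<^sub>R z n = z n" using elim by simp
    ultimately have "z n \<in> C" using Ci_subset by auto
    then show ?case using K_add_ray [OF y(1) _ zL, of n "1 / real n"] by auto
  qed
  then have "\<forall>\<^sub>F n in sequentially. y n + (1 / real n) *\<^sub>R z n \<in> closure (K L C)"
    by (rule eventually_mono) (rule subsetD [OF closure_subset])
  then show ?thesis using Lim_in_closed_set [OF closed_closure _ _ lim] by simp
qed

lemma closure_K_add_C:
  assumes x: "x \<in> closure (K L C)" and s: "s \<in> C" shows "x + s \<in> closure (K L C)"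
proof -
  have lim: "(\<lambda>n. x + (s + (1 / real (Suc n)) *\<^sub>R (u + v))) \<longlonglongrightarrow> x + (s + 0 *\<^sub>R (u + v))"
    by (intro tendsto_intros LIMSEQ_Suc [OF lim_1_over_n])
  have "x + (s + (1 / real (Suc n)) *\<^sub>R (u + v)) \<in> closure (K L C)" for n
    by (intro closure_K_add_Ci x Ci_add s Ci_scale uv_Ci) auto
  then show ?thesis using closed_sequentially [OF closed_closure _ lim] by simp
qed

text \<open>\<open>x + Ci\<close> is open and contained in the closure, and a convex set has the
  same interior as its closure.\<close>

lemma interior_K_add_Ci:
  assumes x: "x \<in> closure (K L C)" and s: "s \<in> Ci" shows "x + s \<in> interior (K L C)"
proof -
  have "(+) x ` Ci \<subseteq> closure (K L C)" using closure_K_add_Ci [OF x] by auto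
  then have "(+) x ` Ci \<subseteq> interior (closure (K L C))"
    by (intro interior_maximal open_translation open_Ci)
  then show ?thesis using s convex_interior_closure [OF convex_K] by auto
qed

lemma P_eq: "P L C = closure (K L C) - interior (K L C)"
  by (simp add: P_def frontier_def)

text \<open>In particular a line in direction \<open>u + v\<close> meets the boundary at most
  once.\<close>

lemma P_not_above:
  assumes "x \<in> P L C" "y \<in> P L C" "y - x \<in> Ci" shows False
proof -
  have "x + (y - x) \<in> interior (K L C)" using assms by (intro interior_K_add_Ci) (auto simp: P_eq)
  then show False using assms by (simp add: P_eq)
qed

lemma P_subset_C: "P L C \<subseteq> C"
  using closure_K_subset_C by (auto simp: P_eq)

lemma G_Ci: obtains k where "k \<in> L" "k \<in> Ci"
proof -
  obtain z where zL: "\<And>n::nat. z n \<in> L" and z: "(\<lambda>n. (1 / real n) *\<^sub>R z n) \<longlonglongrightarrow> u + v"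
    using L_approx by blast
  have "\<forall>\<^sub>F n in sequentially. (1 / real n) *\<^sub>R z n \<in> Ci \<and> n > 0"
    using topological_tendstoD [OF z open_Ci] uv_Ci eventually_gt_at_top [of 0]
    by (auto intro: eventually_conj)
  then obtain n where n: "(1 / real n) *\<^sub>R z n \<in> Ci" "n > 0"
    using eventually_happens by fastforce
  then have "real n *\<^sub>R (1 / real n) *\<^sub>R z n \<in> Ci" by (simp only: Ci_scale of_nat_0_less_iff)
  moreover have "real n *\<^sub>R (1 / real n) *\<^sub>R z n = z n" using n by simp
  ultimately have "z n \<in> Ci" by simp
  then show ?thesis using that zL by blast
qed

lemma Ci_G: "x \<in> Ci \<Longrightarrow> x \<in> L \<Longrightarrow> x \<in> G"
  by (auto simp: G_def Ci_def C_def)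

text \<open>
  If the lattice point close to the line of \<open>u\<close> lies on the wrong side of it, multiples of it are added
  to an interior lattice point.
\<close>

lemma G_near_u:
  assumes "\<epsilon> > 0" obtains k where "k \<in> G" "\<omega> u k < \<epsilon>"
proof -
  obtain z0 where z0: "z0 \<in> L" "z0 \<noteq> 0" "\<bar>\<omega> u z0\<bar> < \<epsilon>" using L_near_line assms by blast
  define z where "z = (if \<omega> z0 v \<ge> 0 then z0 else - z0)"
  have z: "z \<in> L" "z \<noteq> 0" "\<bar>\<omega> u z\<bar> < \<epsilon>" "\<omega> z v \<ge> 0" using z0 by (auto simp: z_def)
  show ?thesis
  proof (cases "\<omega> u z \<ge> 0")
    case True
    then show ?thesis using z that [of z] by (auto simp: G_def C_def)
  next
    case False
    define \<eta> where "\<eta> = - \<omega> u z"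
    have \<eta>: "0 < \<eta>" "\<eta> < \<epsilon>" using False z by (auto simp: \<eta>_def)
    obtain k0 where k0: "k0 \<in> L" "k0 \<in> Ci" using G_Ci by blast
    \<comment> \<open>Subtracting \<open>\<eta>\<close> this often from \<open>\<omega> u k0\<close>
      leaves a remainder that is at least 0 and less than \<open>\<eta>\<close>.\<close>
    define j where "j = \<lfloor>\<omega> u k0 / \<eta>\<rfloor>"
    have j0: "j \<ge> 0" using k0 \<eta> by (auto simp: j_def Ci_def)
    have "of_int j \<le> \<omega> u k0 / \<eta>" "\<omega> u k0 / \<eta> < of_int j + 1" by (auto simp: j_def)
    then have j: "of_int j * \<eta> \<le> \<omega> u k0" "\<omega> u k0 < of_int j * \<eta> + \<eta>" using \<eta> by (auto simp: field_simps)
    define k where "k = k0 + of_int j *\<^sub>R z"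
    have "\<omega> u k = \<omega> u k0 - of_int j * \<eta>" by (simp add: k_def \<eta>_def)
    then have "0 \<le> \<omega> u k" "\<omega> u k < \<epsilon>" using j \<eta> by auto
    moreover have "\<omega> k v > 0" using k0 z j0 by (auto simp: k_def Ci_def intro!: add_pos_nonneg)
    moreover have "k \<in> L" using k0 z by (auto simp: k_def intro!: L_add L_scale)
    moreover have "k \<noteq> 0" using \<open>\<omega> k v > 0\<close> by auto
    ultimately show ?thesis using that [of k] by (auto simp: G_def C_def)
  qed
qed

section \<open>The oriented boundary line\<close>

text \<open>
  Negating \<open>\<omega>\<close> turns every fact about \<open>(u, v)\<close> into one about \<open>(v, u)\<close>, which is the same cone with
  the opposite orientation, and into one about \<open>(- u, v)\<close>, which is the supplementary cone.
\<close>

lemma swap: "lattice_cone L (\<lambda>x y. - \<omega> x y) c b v u"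
  using D anti [of v u]
  by (intro lattice_cone.intro lattice_cone_axioms.intro opposite_form) simp

lemma dual: "lattice_cone L (\<lambda>x y. - \<omega> x y) c b (- u) v"
  using D by (intro lattice_cone.intro lattice_cone_axioms.intro opposite_form) simp

text \<open>The form \<open>\<omega> (u + v)\<close>: the lines in direction \<open>u + v\<close> are its level sets and meet \<open>P L C\<close> once.\<close>

abbreviation g where "g x \<equiv> \<omega> u x + \<omega> v x"

text \<open>The vector is \<open>t / \<omega> u v\<close> times \<open>v\<close> for
  \<open>t \<ge> 0\<close> and \<open>\<bar>t\<bar> / \<omega> u v\<close> times \<open>u\<close>
  otherwise. It lies on an edge of the cone and changes the level \<open>g\<close> by
  \<open>t\<close>.\<close>

lemma wedge_mem: "(t / (2 * \<omega> u v)) *\<^sub>R (v - u) + (\<bar>t\<bar> / (2 * \<omega> u v)) *\<^sub>R (u + v) \<in> C"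
proof -
  let ?x = "(t / (2 * \<omega> u v)) *\<^sub>R (v - u) + (\<bar>t\<bar> / (2 * \<omega> u v)) *\<^sub>R (u + v)"
  have "\<omega> u ?x = (t + \<bar>t\<bar>) / 2" "\<omega> ?x v = (\<bar>t\<bar> - t) / 2" using D by (auto simp: field_simps)
  then show ?thesis unfolding C_def by auto
qed

text \<open>Since \<open>g (v - u) = 2 * \<omega> u v\<close>, this scaling puts
  \<open>base t\<close> on level \<open>t\<close>.\<close>

definition base where "base t = (t / (2 * \<omega> u v)) *\<^sub>R (v - u)"

lemma om_vu: "\<omega> v u = - \<omega> u v" by (rule anti)

lemma g_base: "g (base t + h *\<^sub>R (u + v)) = t"
  using D om_vu by (simp add: base_def field_simps)

lemma g_line: "\<exists>h. x = base (g x) + h *\<^sub>R (u + v)"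
proof -
  define y where "y = x - base (g x)"
  have "g y = 0" using g_base [of "g x" 0] by (simp add: y_def)
  then have "\<omega> y (u + v) = 0" using anti [of y u] anti [of y v] by simp
  moreover have "u + v \<noteq> 0" using uv_Ci by (metis Ci_def less_irrefl mem_Collect_eq om_simps(8))
  ultimately obtain h where "y = h *\<^sub>R (u + v)" using parallel by blast
  then have "x = base (g x) + h *\<^sub>R (u + v)" by (simp add: y_def algebra_simps)
  then show ?thesis ..
qed

lemma hset_nonempty: "\<exists>h. base t + h *\<^sub>R (u + v) \<in> closure (K L C)"
proof -
  obtain k where k: "k \<in> L" "k \<in> Ci" using G_Ci by blast
  then have kK: "k \<in> closure (K L C)" using Ci_G G_K closure_subset by blast
  obtain h0 where h0: "k = base (g k) + h0 *\<^sub>R (u + v)" using g_line by blast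
  define h where "h = \<bar>t - g k\<bar> / (2 * \<omega> u v)"
  have "(base t - base (g k)) + h *\<^sub>R (u + v) \<in> C"
  proof -
    have eq: "base t - base (g k) = ((t - g k) / (2 * \<omega> u v)) *\<^sub>R (v - u)"
      by (simp add: base_def scaleR_diff_left diff_divide_distrib)
    show ?thesis unfolding eq h_def by (rule wedge_mem)
  qed
  then have "k + ((base t - base (g k)) + h *\<^sub>R (u + v)) \<in> closure (K L C)"
    by (rule closure_K_add_C [OF kK])
  moreover have "k + ((base t - base (g k)) + h *\<^sub>R (u + v)) = base t + (h0 + h) *\<^sub>R (u + v)"
    using h0 by (metis (no_types, lifting) add.assoc add.commute add_diff_cancel_left' diff_add_cancel scaleR_add_left)
  ultimately show ?thesis by metis
qed

definition hset where "hset t = {h. base t + h *\<^sub>R (u + v) \<in> closure (K L C)}"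
definition height where "height t = Inf (hset t)"
text \<open>The lowest point, in direction \<open>u + v\<close>, of the closure of the hull on level
  \<open>t\<close>. This curve will parametrise the boundary.\<close>

definition \<gamma> where "\<gamma> t = base t + height t *\<^sub>R (u + v)"

lemma closed_hset: "closed (hset t)"
proof -
  have "hset t = (\<lambda>h. base t + h *\<^sub>R (u + v)) -` closure (K L C)" by (auto simp: hset_def)
  moreover have "closed \<dots>" by (intro continuous_closed_vimage closed_closure continuous_intros)
  ultimately show ?thesis by simp
qed

lemma bdd_hset: "bdd_below (hset t)"
proof -
  have "- \<bar>t\<bar> / (2 * \<omega> u v) \<le> h" if "h \<in> hset t" for h
  proof -
    have "base t + h *\<^sub>R (u + v) \<in> C" using that closure_K_subset_C by (auto simp: hset_def)
    then show ?thesis using D by (auto simp: C_def base_def field_simps abs_if)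
  qed
  then show ?thesis by (intro bdd_belowI) auto
qed

lemma height_mem: "height t \<in> hset t"
  unfolding height_def
  by (intro closed_contains_Inf bdd_hset closed_hset) (use hset_nonempty in \<open>auto simp: hset_def\<close>)

lemma height_le: "base t + h *\<^sub>R (u + v) \<in> closure (K L C) \<Longrightarrow> height t \<le> h"
  unfolding height_def by (intro cInf_lower bdd_hset) (auto simp: hset_def)

lemma \<gamma>_closure: "\<gamma> t \<in> closure (K L C)"
  using height_mem by (simp add: \<gamma>_def hset_def)

lemma g_\<gamma> [simp]: "g (\<gamma> t) = t"
  unfolding \<gamma>_def by (rule g_base)

text \<open>A lowest point in the interior could be moved a little further down along
  \<open>u + v\<close>.\<close>

lemma \<gamma>_P: "\<gamma> t \<in> P L C"
proof -
  have "\<gamma> t \<notin> interior (K L C)"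
  proof
    assume "\<gamma> t \<in> interior (K L C)"
    moreover have "((\<lambda>d. \<gamma> t - d *\<^sub>R (u + v)) \<longlongrightarrow> \<gamma> t) (at_right 0)"
      by (rule tendsto_eq_intros | simp)+
    ultimately have "\<forall>\<^sub>F d in at_right 0. \<gamma> t - d *\<^sub>R (u + v) \<in> interior (K L C)"
      by (rule topological_tendstoD [OF _ open_interior, rotated])
    moreover have "\<forall>\<^sub>F d in at_right 0. d > (0::real)" by (simp add: eventually_at_right_less)
    ultimately have "\<forall>\<^sub>F d in at_right 0. d > 0 \<and> \<gamma> t - d *\<^sub>R (u + v) \<in> interior (K L C)"
      by (auto intro: eventually_conj)
    then obtain d :: real where d: "d > 0" "\<gamma> t - d *\<^sub>R (u + v) \<in> interior (K L C)"
      using eventually_happens' [OF trivial_limit_at_right_real [of 0]] by blast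
    then have "base t + (height t - d) *\<^sub>R (u + v) \<in> closure (K L C)"
      using interior_subset closure_subset by (auto simp: \<gamma>_def algebra_simps)
    then show False using height_le d by fastforce
  qed
  then show ?thesis using \<gamma>_closure by (simp add: P_eq)
qed

lemma P_g_inj:
  assumes "x \<in> P L C" "y \<in> P L C" "g x = g y" shows "x = y"
proof -
  have *: False if "x \<in> P L C" "y \<in> P L C" "x = base t + h1 *\<^sub>R (u + v)" "y = base t + h2 *\<^sub>R (u + v)" "h1 < h2"
    for x y t h1 h2
  proof (rule P_not_above [OF that(1,2)])
    have "y - x = (h2 - h1) *\<^sub>R (u + v)" using that by (simp add: algebra_simps)
    then show "y - x \<in> Ci" using that by (simp only:) (intro Ci_scale uv_Ci, simp)
  qed
  obtain h1 h2 where h: "x = base (g x) + h1 *\<^sub>R (u + v)" "y = base (g x) + h2 *\<^sub>R (u + v)"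
    using g_line [of x] g_line [of y] assms(3) by metis
  then have "h1 = h2" using * assms by (metis linorder_neqE_linordered_idom)
  then show ?thesis using h by metis
qed

lemma \<gamma>_g: "x \<in> P L C \<Longrightarrow> \<gamma> (g x) = x"
  by (rule P_g_inj) (auto simp: \<gamma>_P)

text \<open>Adding the vector of \<open>wedge_mem\<close> takes the lowest point of level
  \<open>t\<close> to a point of the closure on level \<open>t'\<close>, which bounds
  \<open>height t'\<close>.\<close>

lemma height_lipschitz: "height t' \<le> height t + \<bar>t' - t\<bar> / (2 * \<omega> u v)"
proof (rule height_le)
  have eq: "base t' - base t = ((t' - t) / (2 * \<omega> u v)) *\<^sub>R (v - u)"
    by (simp add: base_def scaleR_diff_left diff_divide_distrib)
  have "(base t' - base t) + (\<bar>t' - t\<bar> / (2 * \<omega> u v)) *\<^sub>R (u + v) \<in> C"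
    unfolding eq by (rule wedge_mem)
  then have "\<gamma> t + ((base t' - base t) + (\<bar>t' - t\<bar> / (2 * \<omega> u v)) *\<^sub>R (u + v)) \<in> closure (K L C)"
    by (rule closure_K_add_C [OF \<gamma>_closure])
  then show "base t' + (height t + \<bar>t' - t\<bar> / (2 * \<omega> u v)) *\<^sub>R (u + v) \<in> closure (K L C)"
    by (simp add: \<gamma>_def algebra_simps)
qed

lemma continuous_height: "continuous_on UNIV height"
proof (rule lipschitz_on_continuous_on)
  show "(1 / (2 * \<omega> u v))-lipschitz_on UNIV height"
  proof (rule lipschitz_onI)
    fix x y :: real
    show "dist (height x) (height y) \<le> 1 / (2 * \<omega> u v) * dist x y"
      using height_lipschitz [of x y] height_lipschitz [of y x]
      by (auto simp: dist_real_def abs_if split: if_splits)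
  qed (use D in auto)
qed

lemma continuous_\<gamma>: "continuous_on UNIV \<gamma>"
  unfolding \<gamma>_def [abs_def] base_def
  by (intro continuous_intros continuous_on_subset [OF continuous_height]) (use D in auto)

section \<open>The ends of the boundary line and its orientation\<close>

lemma \<gamma>_near_u: "((\<lambda>t. infdist (\<gamma> t) ru) \<longlongrightarrow> 0) at_bot"
proof (rule tendstoI)
  fix e :: real assume e: "e > 0"
  define \<delta> where "\<delta> = e * \<omega> u v / (norm v + 1)"
  have nv: "norm v + 1 > 0" by (smt (verit) norm_ge_zero)
  have "\<delta> > 0" using e D nv by (simp add: \<delta>_def)
  then obtain k where k: "k \<in> G" "\<omega> u k < \<delta>" using G_near_u by blast
  have kK: "k \<in> closure (K L C)" using k G_K closure_subset by blast
  have "infdist (\<gamma> t) ru < e" if t: "t \<le> g k" for t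
  proof -
    \<comment> \<open>Moving from \<open>k\<close> along \<open>u\<close> keeps
      \<open>\<omega> u\<close> fixed and, as \<open>g u = - \<omega> u v\<close>, reaches level
      \<open>t\<close>. The lowest point there has a value of \<open>\<omega> u\<close> that is no
      larger.\<close>
    define s where "s = (g k - t) / \<omega> u v"
    define x where "x = k + s *\<^sub>R u"
    have "x \<in> closure (K L C)" unfolding x_def
      by (rule closure_K_add_C [OF kK]) (use D t in \<open>auto simp: s_def C_def\<close>)
    moreover have gx: "g x = t" using D om_vu by (simp add: x_def s_def)
    then obtain h where h: "x = base t + h *\<^sub>R (u + v)" using g_line by metis
    ultimately have "height t \<le> h" using height_le by blast
    then have "\<omega> u (\<gamma> t) \<le> \<omega> u x" using D h by (simp add: \<gamma>_def)
    also have "\<dots> < \<delta>" using k by (simp add: x_def)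
    finally have lt: "\<omega> u (\<gamma> t) < \<delta>" .
    have C: "\<gamma> t \<in> C" using \<gamma>_P P_subset_C by blast
    define y where "y = (\<omega> (\<gamma> t) v / \<omega> u v) *\<^sub>R u"
    have "y \<in> ru" unfolding ru_iff using C D by (simp add: y_def C_def)
    then have "infdist (\<gamma> t) ru \<le> dist (\<gamma> t) y" by (rule infdist_le)
    also have "\<gamma> t - y = (\<omega> u (\<gamma> t) / \<omega> u v) *\<^sub>R v"
      using cone_expand [of "\<gamma> t"] by (simp add: y_def algebra_simps)
    then have "dist (\<gamma> t) y = \<omega> u (\<gamma> t) / \<omega> u v * norm v"
      using C D by (simp add: dist_norm C_def)
    also have "\<dots> \<le> \<omega> u (\<gamma> t) / \<omega> u v * (norm v + 1)"
      using C D by (intro mult_left_mono) (auto simp: C_def)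
    also have "\<dots> < \<delta> / \<omega> u v * (norm v + 1)"
      using lt D nv by (intro mult_strict_right_mono divide_strict_right_mono) auto
    also have "\<dots> = e" using D nv by (simp add: \<delta>_def)
    finally show ?thesis .
  qed
  then show "\<forall>\<^sub>F t in at_bot. dist (infdist (\<gamma> t) ru) 0 < e"
    unfolding eventually_at_bot_linorder by (auto intro!: exI [of _ "g k"] simp: infdist_nonneg)
qed

text \<open>Points on very negative levels are far from the ray of \<open>v\<close>; this will
  exclude parametrisations that run backwards.\<close>

lemma far_from_v:
  obtains M where "M > 0" "\<And>x. x \<in> C \<Longrightarrow> - g x \<le> infdist x rv * M"
proof -
  obtain M where M: "M > 0" "\<And>x y. \<bar>\<omega> x y\<bar> \<le> norm x * norm y * M" using om_mult_bound by blast
  have "- g x \<le> infdist x rv * (norm v * M + 1)" if x: "x \<in> C" for x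
  proof -
    have 1: "- g x \<le> \<omega> x v" using x anti [of v x] by (auto simp: C_def)
    have nM: "norm v * M + 1 > 0" using M by (smt (verit) mult_nonneg_nonneg norm_ge_zero)
    have "0 \<in> rv" by (auto intro: exI [of _ 0])
    then have ne: "rv \<noteq> {}" by blast
    have "\<omega> x v / (norm v * M + 1) \<le> infdist x rv"
      unfolding infdist_notempty [OF ne]
    proof (rule cINF_greatest)
      show "rv \<noteq> {}" by (rule ne)
      fix y assume "y \<in> rv"
      then have "\<omega> y v = 0" unfolding rv_iff by simp
      then have "\<omega> x v = \<omega> (x - y) v" by simp
      also have "\<dots> \<le> dist x y * (norm v * M)" using M(2) [of "x - y" v] by (simp add: dist_norm mult.assoc)
      also have "\<dots> \<le> dist x y * (norm v * M + 1)" by (intro mult_left_mono) auto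
      finally show "\<omega> x v / (norm v * M + 1) \<le> dist x y" using nM by (simp add: field_simps)
    qed
    then have "\<omega> x v \<le> infdist x rv * (norm v * M + 1)" using nM by (simp add: field_simps)
    then show ?thesis using 1 by linarith
  qed
  moreover have "norm v * M + 1 > 0" using M by (smt (verit) mult_nonneg_nonneg norm_ge_zero)
  ultimately show ?thesis using that by blast
qed


lemma swap_C: "lattice_cone.C (\<lambda>x y. - \<omega> x y) v u = C"
proof -
  interpret s: lattice_cone L "\<lambda>x y. - \<omega> x y" c b v u by (rule swap)
  show ?thesis unfolding s.C_def C_def using anti [of _ u] anti [of v] by auto
qed

lemma \<gamma>_near_v: "((\<lambda>t. infdist (\<gamma> t) rv) \<longlongrightarrow> 0) at_top"
proof -
  interpret s: lattice_cone L "\<lambda>x y. - \<omega> x y" c b v u by (rule swap)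
  \<comment> \<open>Exchanging \<open>u\<close> and \<open>v\<close> and negating
    \<open>\<omega>\<close> negates \<open>g\<close>, so level \<open>- t\<close> of the reversed
    line is level \<open>t\<close> here.\<close>
  have "s.\<gamma> (- t) = \<gamma> t" for t
  proof (rule P_g_inj)
    show "s.\<gamma> (- t) \<in> P L C" using s.\<gamma>_P swap_C by simp
    show "g (s.\<gamma> (- t)) = g (\<gamma> t)" using s.g_\<gamma> [of "- t"] by simp
  qed (rule \<gamma>_P)
  then show ?thesis using s.\<gamma>_near_u unfolding filterlim_at_bot_mirror by simp
qed

lemma \<gamma>_oriented: "oriented_parametrisation L ru rv \<gamma>"
  unfolding oriented_parametrisation_def angle_eq
proof (intro conjI continuous_\<gamma> \<gamma>_near_u \<gamma>_near_v)
  show "inj \<gamma>" by (rule injI) (metis g_\<gamma>)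
  show "range \<gamma> = P L C"
  proof
    show "P L C \<subseteq> range \<gamma>" using \<gamma>_g by (metis rangeI subsetI)
  qed (use \<gamma>_P in auto)
qed

text \<open>An injective continuous real function is strictly monotone. A decreasing one would keep
  \<open>g\<close> below \<open>- M\<close> after \<open>t0\<close> while the curve approaches the
  ray of \<open>v\<close>, against \<open>far_from_v\<close>.\<close>

lemma oriented_strict_mono:
  assumes "oriented_parametrisation L ru rv \<delta>" shows "strict_mono (\<lambda>t. g (\<delta> t))"
proof -
  have d: "continuous_on UNIV \<delta>" "inj \<delta>" "range \<delta> = P L C"
    and lim: "((\<lambda>t. infdist (\<delta> t) rv) \<longlongrightarrow> 0) at_top"
    using assms unfolding oriented_parametrisation_def angle_eq by auto
  have cont: "continuous_on UNIV (\<lambda>t. g (\<delta> t))" by (intro continuous_intros d)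
  have inj: "inj (\<lambda>t. g (\<delta> t))"
  proof (rule injI)
    fix s t assume "g (\<delta> s) = g (\<delta> t)"
    then have "\<delta> s = \<delta> t" using d(3) by (intro P_g_inj) auto
    then show "s = t" using d(2) by (simp add: inj_eq)
  qed
  have "\<not> strict_antimono_on UNIV (\<lambda>t. g (\<delta> t))"
  proof
    assume anti: "strict_antimono_on UNIV (\<lambda>t. g (\<delta> t))"
    obtain M where M: "M > 0" "\<And>x. x \<in> C \<Longrightarrow> - g x \<le> infdist x rv * M" using far_from_v by blast
    have "\<gamma> (- M) \<in> range \<delta>" using \<gamma>_P d(3) by auto
    then obtain t0 where "\<delta> t0 = \<gamma> (- M)" by auto
    then have t0: "g (\<delta> t0) = - M" using g_\<gamma> [of "- M"] by metis
    have "\<forall>\<^sub>F t in at_top. infdist (\<delta> t) rv < 1"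
      using order_tendstoD(2) [OF lim, of 1] by simp
    then have "\<forall>\<^sub>F t in at_top. infdist (\<delta> t) rv < 1 \<and> t > t0"
      using eventually_gt_at_top by (rule eventually_conj)
    then obtain t where t: "infdist (\<delta> t) rv < 1" "t > t0"
      using eventually_happens' [OF trivial_limit_at_top_linorder] by blast
    have "g (\<delta> t) < - M" using anti t(2) unfolding monotone_on_def t0 [symmetric] by blast
    moreover have "\<delta> t \<in> C" using d(3) P_subset_C by blast
    then have "- g (\<delta> t) \<le> infdist (\<delta> t) rv * M" by (rule M)
    moreover have "infdist (\<delta> t) rv * M < 1 * M" using t M by (intro mult_strict_right_mono)
    ultimately show False by simp
  qed
  then show ?thesis
    using injective_eq_monotone_map [OF is_interval_univ cont] inj by simp
qed

text \<open>The order does not depend on the parametrisation, because \<open>g\<close> increases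
  along every admissible one; \<open>\<gamma>\<close> is a witness.\<close>

lemma before_iff: "before L ru rv A B \<longleftrightarrow> A \<in> P L C \<and> B \<in> P L C \<and> g A < g B"
proof
  assume "before L ru rv A B"
  then obtain \<delta> s t where \<delta>: "oriented_parametrisation L ru rv \<delta>" and st: "s < t" "\<delta> s = A" "\<delta> t = B"
    by (auto simp: before_def)
  have "range \<delta> = P L C" using \<delta> unfolding oriented_parametrisation_def angle_eq by auto
  moreover have "g (\<delta> s) < g (\<delta> t)" using oriented_strict_mono [OF \<delta>] st(1) by (rule strict_monoD)
  ultimately show "A \<in> P L C \<and> B \<in> P L C \<and> g A < g B" using st by auto
next
  assume "A \<in> P L C \<and> B \<in> P L C \<and> g A < g B"
  then show "before L ru rv A B"
    unfolding before_def using \<gamma>_oriented \<gamma>_g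
    by (intro exI [of _ \<gamma>] exI [of _ "g A"] exI [of _ "g B"] conjI) auto
qed

text \<open>\<open>plucker\<close> turns the hypothesis into an inequality between products of cone
  coordinates. Together with \<open>g B \<le> g A\<close> it forces \<open>A - B\<close> or
  \<open>B - A\<close> into \<open>Ci\<close>, against \<open>P_not_above\<close>.\<close>

lemma g_less_if_om_pos:
  assumes A: "A \<in> P L C" and B: "B \<in> P L C" and pos: "0 < \<omega> A B" shows "g A < g B"
proof (rule ccontr)
  assume "\<not> g A < g B"
  then have le: "\<omega> u B - \<omega> B v \<le> \<omega> u A - \<omega> A v" using anti [of v A] anti [of v B] by simp
  have nn: "0 \<le> \<omega> u A" "0 \<le> \<omega> A v" "0 \<le> \<omega> u B" "0 \<le> \<omega> B v"
    using A B P_subset_C by (auto simp: C_def)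
  have "\<omega> u v * \<omega> A B = \<omega> A v * \<omega> u B - \<omega> u A * \<omega> B v"
    using plucker [of u v A B] anti [of v B] by simp
  then have p: "\<omega> u A * \<omega> B v < \<omega> A v * \<omega> u B" using D pos by (smt (verit) mult_pos_pos)
  show False
  proof (cases "\<omega> A v > \<omega> B v")
    case True
    then have "A - B \<in> Ci" using le p nn
      by (auto simp: Ci_def)
    then show False using P_not_above B A by blast
  next
    case False
    then have "\<omega> u A * \<omega> A v < \<omega> u B * \<omega> A v"
      using p nn mult_left_mono [of "\<omega> A v" "\<omega> B v" "\<omega> u A"] by (simp add: mult.commute)
    then have "\<omega> u A < \<omega> u B" using nn by (simp add: mult_less_cancel_right)
    moreover have "\<omega> A v < \<omega> B v" using le \<open>\<omega> u A < \<omega> u B\<close> by linarith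
    ultimately have "B - A \<in> Ci" by (auto simp: Ci_def)
    then show False using P_not_above A B by blast
  qed
qed

section \<open>Edges\<close>

definition C'i where "C'i = {p. 0 < \<omega> u p \<and> 0 < \<omega> v p}"

lemma om_decomp: "\<omega> u v * \<omega> x p = \<omega> x v * \<omega> u p + \<omega> u x * \<omega> v p"
  by (rule plucker)

lemma om_C_C': assumes "x \<in> C" "p \<in> C'" shows "0 \<le> \<omega> x p"
proof -
  have "0 \<le> \<omega> u v * \<omega> x p" unfolding om_decomp using assms by (auto simp: C_def C'_def)
  then show ?thesis using D by (simp add: zero_le_mult_iff)
qed

lemma om_Ci_C': assumes "x \<in> Ci" "p \<in> C'" "p \<noteq> 0" shows "0 < \<omega> x p"
proof -
  have nz: "\<omega> u p \<noteq> 0 \<or> \<omega> v p \<noteq> 0"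
    using cone_eqI [of p 0] assms(3) anti [of v p] by auto
  have "0 \<le> \<omega> u p" "0 \<le> \<omega> v p" "0 < \<omega> x v" "0 < \<omega> u x" using assms by (auto simp: Ci_def C'_def)
  then have "0 < \<omega> x v * \<omega> u p + \<omega> u x * \<omega> v p"
    using nz by (intro pos_combination) auto
  then have "0 < \<omega> u v * \<omega> x p" unfolding om_decomp .
  then show ?thesis using D by (simp add: zero_less_mult_iff)
qed

lemma om_C_C'i: assumes "x \<in> C" "x \<noteq> 0" "p \<in> C'i" shows "0 < \<omega> x p"
proof -
  have nz: "\<omega> u x \<noteq> 0 \<or> \<omega> x v \<noteq> 0" using cone_eqI [of x 0] assms(2) by auto
  have "0 < \<omega> u p" "0 < \<omega> v p" "0 \<le> \<omega> x v" "0 \<le> \<omega> u x" using assms by (auto simp: C_def C'i_def)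
  then have "0 < \<omega> x v * \<omega> u p + \<omega> u x * \<omega> v p"
    using nz by (intro pos_combination) auto
  then have "0 < \<omega> u v * \<omega> x p" unfolding om_decomp .
  then show ?thesis using D by (simp add: zero_less_mult_iff)
qed

lemma g_pos: "w \<in> C' \<Longrightarrow> w \<noteq> 0 \<Longrightarrow> 0 < g w"
  using om_Ci_C' [OF uv_Ci] by simp

section \<open>Supporting lines and the lattice points on edges\<close>

lemma K_ge:
  assumes "linear f" "\<And>x. x \<in> G \<Longrightarrow> d \<le> f x" "x \<in> K L C" shows "d \<le> (f x :: real)"
proof -
  have "convex {x. d \<le> f x}"
    using convex_linear_vimage [OF assms(1), of "{d..}"] by (simp add: vimage_def)
  then have "K L C \<subseteq> {x. d \<le> f x}" using assms(2) by (intro K_minimal) auto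
  then show ?thesis using assms(3) by auto
qed

lemma zero_notin_K: "0 \<notin> K L C"
proof -
  \<comment> \<open>The form pairing with \<open>v - u\<close> is positive on the cone without its
    apex, hence on the hull.\<close>
  have "v - u \<in> C'i" using D anti [of v u] by (auto simp: C'i_def)
  moreover have "convex {x. 0 < \<omega> x (v - u)}"
    using convex_linear_vimage [OF linear_om_left, of "{0<..}" "v - u"] by (simp add: vimage_def)
  ultimately have "K L C \<subseteq> {x. 0 < \<omega> x (v - u)}"
    using om_C_C'i by (intro K_minimal) (auto simp only: G_def)
  then show ?thesis by auto
qed

lemma K_L_G: "x \<in> K L C \<Longrightarrow> x \<in> L \<Longrightarrow> x \<in> G"
  using K_subset_C zero_notin_K by (auto simp: G_def)

lemma face_line:
  assumes "\<And>x. x \<in> K L C \<Longrightarrow> d \<le> \<omega> x w"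
  shows "{x \<in> K L C. \<omega> x w = d} face_of K L C"
  unfolding face_of_def
proof (intro conjI ballI impI)
  show "convex {x \<in> K L C. \<omega> x w = d}"
    using convex_Int [OF convex_K convex_linear_vimage [OF linear_om_left, of "{d}" w]]
    by (simp add: vimage_def Int_def)
  fix a b x assume "a \<in> K L C" "b \<in> K L C" "x \<in> {x \<in> K L C. \<omega> x w = d}" "x \<in> open_segment a b"
  then show "a \<in> {x \<in> K L C. \<omega> x w = d}" "b \<in> {x \<in> K L C. \<omega> x w = d}"
    using linear_min_open_segment [OF _ linear_om_left, of x a b w d] assms by auto
qed auto

lemma aff_dim_line:
  assumes "w \<noteq> 0" "A \<in> S" "A + w \<in> S" "\<And>x. x \<in> S \<Longrightarrow> \<omega> x w = d"
  shows "aff_dim S = 1"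
proof -
  have 2: "aff_dim {A, A + w} = 1" using assms by (simp add: aff_dim_2)
  have "aff_dim {A, A + w} \<le> aff_dim S" using assms by (intro aff_dim_subset) auto
  moreover have "S \<subseteq> affine hull {A, A + w}"
  proof
    fix x assume "x \<in> S"
    then have "\<omega> (x - A) w = 0" using assms by simp
    then obtain t where "x - A = t *\<^sub>R w" using parallel assms(1) by blast
    then have "x = (1 - t) *\<^sub>R A + t *\<^sub>R (A + w)" by (simp add: algebra_simps)
    then show "x \<in> affine hull {A, A + w}" unfolding affine_hull_2
      by (intro CollectI exI [of _ "1 - t"] exI [of _ t]) simp
  qed
  then have "aff_dim S \<le> aff_dim {A, A + w}"
    using aff_dim_subset aff_dim_affine_hull by metis
  ultimately show ?thesis using 2 by simp
qed

text \<open>\<open>w\<close> is the direction and \<open>d\<close> the level of the supporting line.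
  Membership in \<open>C'\<close> fixes the sign of \<open>w\<close>, from the end near
  \<open>u\<close> to the end near \<open>v\<close>. One notion covers unbounded edges
  (\<open>d = 0\<close>) and bounded ones (\<open>d = 1\<close>).\<close>

definition edge_data :: "'a \<Rightarrow> real \<Rightarrow> 'a set \<Rightarrow> bool" where
  "edge_data w d e \<longleftrightarrow> prim w \<and> w \<in> C' \<and> (d = 0 \<or> d = 1) \<and> (\<forall>x\<in>K L C. d \<le> \<omega> x w) \<and>
     e = {x \<in> K L C. \<omega> x w = d} \<and> (\<exists>A\<in>L. A \<in> e \<and> A + w \<in> e)"

lemma edge_data_face: "edge_data w d e \<Longrightarrow> e face_of K L C"
  using face_line by (auto simp: edge_data_def)

lemma edge_data_edge:
  assumes e: "edge_data w d e" shows "e \<in> edges L C"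
proof -
  obtain A where A: "A \<in> e" "A + w \<in> e" using e unfolding edge_data_def by blast
  have "aff_dim e = 1"
    by (rule aff_dim_line [OF _ A]) (use e prim_nonzero in \<open>auto simp: edge_data_def\<close>)
  then show ?thesis using edge_data_face [OF e] by (simp add: edges_def edge_of_def)
qed

text \<open>The level is the minimum of the form of \<open>w\<close> on the hull, so
  \<open>w\<close> determines it.\<close>

lemma edge_data_unique: "edge_data w d e \<Longrightarrow> edge_data w d' e' \<Longrightarrow> e = e'"
proof -
  assume a: "edge_data w d e" "edge_data w d' e'"
  then obtain A A' where "A \<in> e" "A' \<in> e'" unfolding edge_data_def by blast
  then have "d \<le> \<omega> A' w" "\<omega> A' w = d'" "d' \<le> \<omega> A w" "\<omega> A w = d" using a unfolding edge_data_def by auto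
  then have "d = d'" by linarith
  then show ?thesis using a by (simp add: edge_data_def)
qed

text \<open>By the face property, the points of the hull that are outside \<open>e\<close> or in
  \<open>?T\<close> form a convex set, and it contains \<open>G\<close>.\<close>

lemma face_subset_hull:
  assumes "e face_of K L C" shows "e \<subseteq> convex hull (e \<inter> G)"
proof -
  let ?T = "convex hull (e \<inter> G)"
  have "K L C \<subseteq> {x \<in> K L C. x \<in> e \<longrightarrow> x \<in> ?T}"
  proof (rule K_minimal)
    show "convex {x \<in> K L C. x \<in> e \<longrightarrow> x \<in> ?T}"
    proof (rule iffD2 [OF convex_contains_open_segment], intro ballI subsetI)
      fix a b x assume a: "a \<in> {x \<in> K L C. x \<in> e \<longrightarrow> x \<in> ?T}" "b \<in> {x \<in> K L C. x \<in> e \<longrightarrow> x \<in> ?T}"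
        "x \<in> open_segment a b"
      then have "x \<in> K L C" using convex_K [unfolded convex_contains_open_segment] by blast
      moreover have "x \<in> ?T" if "x \<in> e"
      proof -
        have "a \<in> e" "b \<in> e" using assms a that unfolding face_of_def by auto
        then have "a \<in> ?T" "b \<in> ?T" using a by auto
        then show ?thesis using a(3) iffD1 [OF convex_contains_open_segment convex_convex_hull] by blast
      qed
      ultimately show "x \<in> {x \<in> K L C. x \<in> e \<longrightarrow> x \<in> ?T}" by blast
    qed
  qed (auto intro: hull_inc G_K)
  then show ?thesis using assms by (auto simp: face_of_def)
qed

lemma interior_K_nonempty: "interior (K L C) \<noteq> {}"
proof -
  obtain k where "k \<in> L" "k \<in> Ci" using G_Ci by blast
  then have "k \<in> closure (K L C)" using Ci_G G_K closure_subset by blast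
  then show ?thesis using interior_K_add_Ci uv_Ci by blast
qed

text \<open>An edge is spanned by its lattice points, so it has at least two. The primitive vector
  along their difference does not leave the edge.\<close>

lemma edge_two_points:
  assumes "e \<in> edges L C"
  obtains A w where "prim w" "A \<in> e" "A \<in> L" "A + w \<in> e"
proof -
  have e: "e face_of K L C" "aff_dim e = 1" using assms by (auto simp: edges_def edge_of_def)
  have "\<exists>A B. A \<in> e \<inter> G \<and> B \<in> e \<inter> G \<and> A \<noteq> B"
  proof (rule ccontr)
    assume "\<not> ?thesis"
    then obtain a where "e \<inter> G \<subseteq> {a}" by (metis insertI1 subsetI)
    then have "convex hull (e \<inter> G) \<subseteq> {a}" using hull_mono [of "e \<inter> G" "{a}" convex] by simp
    then have "e \<subseteq> {a}" using face_subset_hull [OF e(1)] by blast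
    then have "aff_dim e \<le> 0" using aff_dim_subset [of e "{a}"] by simp
    then show False using e by simp
  qed
  then obtain A B where AB: "A \<in> e" "A \<in> G" "B \<in> e" "B \<in> G" "A \<noteq> B" by blast
  then have "B - A \<in> L" "B - A \<noteq> 0" by (auto simp: G_def intro: L_diff)
  then obtain w k where w: "prim w" "k \<ge> (1::int)" "B - A = of_int k *\<^sub>R w" using prim_multiple by blast
  have "w = (1 / of_int k) *\<^sub>R (B - A)" using w by simp
  then have "A + w = (1 - 1 / of_int k) *\<^sub>R A + (1 / of_int k) *\<^sub>R B"
    by (simp add: algebra_simps)
  moreover have "\<dots> \<in> e"
    by (rule convexD [OF face_of_imp_convex [OF e(1)] AB(1,3)]) (use w in auto)
  ultimately show ?thesis using that w(1) AB by (auto simp: G_def)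
qed

text \<open>A line separating \<open>e\<close> from the interior of the hull supports the hull along
  \<open>e\<close>. Its normal form vanishes on \<open>w0\<close>, so it is a multiple of pairing
  with \<open>w0\<close>, and the sign of the factor decides between \<open>w0\<close> and
  \<open>- w0\<close>.\<close>

lemma edge_support:
  assumes "e \<in> edges L C"
  obtains A w where "prim w" "A \<in> e" "A \<in> L" "A + w \<in> e"
    "\<And>x. x \<in> K L C \<Longrightarrow> \<omega> A w \<le> \<omega> x w" "\<And>x. x \<in> e \<Longrightarrow> \<omega> x w = \<omega> A w"
proof -
  obtain A0 w0 where w0: "prim w0" "A0 \<in> e" "A0 \<in> L" "A0 + w0 \<in> e" using edge_two_points assms by blast
  have e: "e face_of K L C" "aff_dim e = 1" using assms by (auto simp: edges_def edge_of_def)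
  have cl: "closure (interior (K L C)) = closure (K L C)"
    by (rule convex_closure_interior [OF convex_K interior_K_nonempty])
  have "aff_dim (K L C) = 2"
    using aff_dim_nonempty_interior [OF interior_K_nonempty] dim2 by simp
  then have "e \<noteq> K L C" using e by auto
  then have "e \<inter> interior (K L C) = {}" using face_of_disjoint_interior e by blast
  then obtain a \<beta> where ab: "a \<noteq> 0" "\<And>x. x \<in> e \<Longrightarrow> a \<bullet> x \<le> \<beta>" "\<And>x. x \<in> interior (K L C) \<Longrightarrow> \<beta> \<le> a \<bullet> x"
    using separating_hyperplane_sets [of e "interior (K L C)"] face_of_imp_convex [OF e(1)]
      convex_interior [OF convex_K] interior_K_nonempty w0 by blast
  have "closure (interior (K L C)) \<subseteq> {x. \<beta> \<le> a \<bullet> x}"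
    using ab(3) by (intro closure_minimal closed_halfspace_ge) (auto simp: inner_commute)
  then have K: "\<beta> \<le> a \<bullet> x" if "x \<in> K L C" for x using that cl closure_subset by blast
  have "e \<subseteq> K L C" using e(1) by (rule face_of_imp_subset)
  then have eq: "a \<bullet> x = \<beta>" if "x \<in> e" for x using that K ab(2) by (force intro: antisym)
  have aw: "a \<bullet> w0 = 0" using eq [OF w0(2)] eq [OF w0(4)] by (simp add: inner_add_right)
  obtain y where y: "y \<in> L" "\<omega> y w0 = 1" using w0 by (auto simp: prim_def)
  have ax: "a \<bullet> x = \<omega> x w0 * (a \<bullet> y)" for x
    using arg_cong [OF lattice_basis [OF y(2), of x], of "inner a"] aw by (simp add: inner_add_right)
  have ay: "a \<bullet> y \<noteq> 0" using ax [of a] ab(1) by auto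
  show ?thesis
  proof (cases "a \<bullet> y > 0")
    case True
    have "\<omega> A0 w0 \<le> \<omega> x w0" if "x \<in> K L C" for x
      using K [OF that] eq [OF w0(2)] unfolding ax [of x] ax [of A0]
      using True by (metis mult_le_cancel_right_pos)
    moreover have "\<omega> x w0 = \<omega> A0 w0" if "x \<in> e" for x
      using eq [OF that] eq [OF w0(2)] unfolding ax [of x] ax [of A0]
      using True by (metis mult_cancel_right less_irrefl)
    ultimately show ?thesis using that w0 by blast
  next
    case False
    then have F: "a \<bullet> y < 0" using ay by simp
    \<comment> \<open>Reversing the direction makes \<open>A0 + w0\<close> the initial
      point.\<close>
    have "\<omega> (A0 + w0) (- w0) \<le> \<omega> x (- w0)" if "x \<in> K L C" for x
    proof -
      have "\<omega> x w0 \<le> \<omega> A0 w0"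
        using K [OF that] eq [OF w0(2)] unfolding ax [of x] ax [of A0]
        using F by (metis mult_le_cancel_right_neg)
      then show ?thesis by simp
    qed
    moreover have "\<omega> x (- w0) = \<omega> (A0 + w0) (- w0)" if "x \<in> e" for x
    proof -
      have "\<omega> x w0 = \<omega> A0 w0"
        using eq [OF that] eq [OF w0(2)] unfolding ax [of x] ax [of A0]
        using F by (metis mult_cancel_right less_irrefl)
      then show ?thesis by simp
    qed
    moreover have "A0 + w0 \<in> L" using w0 by (auto simp: prim_def intro: L_add)
    moreover have "A0 + w0 + - w0 \<in> e" using w0 by simp
    ultimately show ?thesis using that [of "- w0" "A0 + w0"] w0 prim_minus by blast
  qed
qed

text \<open>The closure of the hull absorbs the whole cone, so a form bounded below on it cannot be
  negative at a cone vector.\<close>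

lemma support_C':
  assumes "\<And>x. x \<in> K L C \<Longrightarrow> d \<le> \<omega> x w" shows "w \<in> C'"
proof -
  obtain k where "k \<in> L" "k \<in> Ci" using G_Ci by blast
  then have k: "k \<in> closure (K L C)" using Ci_G G_K closure_subset by blast
  have cl: "closure (K L C) \<subseteq> {x. d \<le> \<omega> x w}"
    by (intro closure_minimal closed_Collect_le continuous_intros) (use assms in auto)
  have "0 \<le> \<omega> s w" if s: "s \<in> C" for s
  proof (rule ccontr)
    assume "\<not> 0 \<le> \<omega> s w"
    then have neg: "\<omega> s w < 0" by simp
    \<comment> \<open>Large enough for the value at \<open>k + t s\<close> to drop below
      \<open>d\<close>.\<close>
    define t where "t = (\<bar>\<omega> k w\<bar> + \<bar>d\<bar> + 1) / (- \<omega> s w)"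
    have "t \<ge> 0" unfolding t_def using neg by (intro divide_nonneg_pos) auto
    then have "k + t *\<^sub>R s \<in> closure (K L C)" using s by (intro closure_K_add_C k C_scale)
    then have "d \<le> \<omega> k w + t * \<omega> s w" using cl by auto
    moreover have "t * \<omega> s w = - (\<bar>\<omega> k w\<bar> + \<bar>d\<bar> + 1)" using neg by (simp add: t_def)
    ultimately show False by linarith
  qed
  moreover have "u \<in> C" "v \<in> C" using D by (auto simp: C_def)
  ultimately show ?thesis by (simp add: C'_def)
qed

text \<open>
  If the height \<open>d = \<omega> A w\<close> is at least 2 and \<open>\<omega> y w = 1\<close>, then for a suitable integer \<open>q\<close> the
  lattice point \<open>A - y - q w\<close> of height \<open>d - 1\<close> lies in the triangle \<open>O\<close>, \<open>A\<close>, \<open>A + w\<close>.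
\<close>

lemma edge_at_height_le_1:
  assumes w: "prim w" and A: "A \<in> C" "A + w \<in> C" "A \<in> L"
    and min: "\<And>x. x \<in> K L C \<Longrightarrow> \<omega> A w \<le> \<omega> x w"
  shows "\<omega> A w \<le> 1"
proof (rule ccontr)
  assume "\<not> \<omega> A w \<le> 1"
  moreover have "\<omega> A w \<in> \<int>" using A w by (auto simp: prim_def intro: L_om)
  ultimately obtain d :: int where d: "\<omega> A w = of_int d" "d \<ge> 2" by (force elim!: Ints_cases)
  obtain y where y: "y \<in> L" "\<omega> y w = 1" using w by (auto simp: prim_def)
  have "\<omega> y A \<in> \<int>" using y A by (auto intro: L_om)
  then obtain m :: int where m: "\<omega> y A = of_int m" by (auto elim!: Ints_cases)
  have Ay: "A = of_int d *\<^sub>R y + of_int m *\<^sub>R w" using lattice_basis [OF y(2), of A] d m by simp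
  \<comment> \<open>Since \<open>r\<close> is a remainder, both \<open>r\<close> and
    \<open>d - 1 - r\<close> are nonnegative; they become the coefficients of \<open>A + w\<close>
    and \<open>A\<close> in \<open>d x\<close>.\<close>
  define q r where "q = m div d" and "r = m mod d"
  have r: "0 \<le> r" "r < d" "m = q * d + r" using d by (auto simp: q_def r_def)
  define x where "x = A - y - of_int q *\<^sub>R w"
  have "of_int d *\<^sub>R x = of_int d *\<^sub>R A - (of_int d *\<^sub>R y + of_int (q * d) *\<^sub>R w)"
    by (simp add: x_def algebra_simps)
  also have "of_int d *\<^sub>R y = A - of_int m *\<^sub>R w" using Ay by (simp add: algebra_simps)
  also have "of_int d *\<^sub>R A - (A - of_int m *\<^sub>R w + of_int (q * d) *\<^sub>R w)
      = of_int (d - 1 - r) *\<^sub>R A + of_int r *\<^sub>R (A + w)"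
    using r(3) by (simp add: algebra_simps)
  finally have "of_int d *\<^sub>R x = of_int (d - 1 - r) *\<^sub>R A + of_int r *\<^sub>R (A + w)" .
  moreover have "of_int (d - 1 - r) *\<^sub>R A + of_int r *\<^sub>R (A + w) \<in> C"
    by (intro C_add [OF C_scale C_scale] A) (use r in auto)
  ultimately have "of_int d *\<^sub>R x \<in> C" by (simp only:)
  then have "(1 / of_int d) *\<^sub>R of_int d *\<^sub>R x \<in> C" by (rule C_scale [rotated]) (use d in simp)
  then have "x \<in> C" using d by simp
  moreover have "x \<in> L" using A y w by (auto simp: x_def prim_def intro!: L_diff L_scale)
  moreover have ox: "\<omega> x w = of_int d - 1" using y d by (simp add: x_def)
  moreover have "x \<noteq> 0" using ox d by auto
  ultimately have "x \<in> K L C" by (intro G_K) (auto simp: G_def)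
  then show False using min [of x] ox d by simp
qed

lemma edge_cases:
  assumes "e \<in> edges L C" obtains w d where "edge_data w d e"
proof -
  obtain A w where w: "prim w" "A \<in> e" "A \<in> L" "A + w \<in> e"
    and min: "\<And>x. x \<in> K L C \<Longrightarrow> \<omega> A w \<le> \<omega> x w" and eq: "\<And>x. x \<in> e \<Longrightarrow> \<omega> x w = \<omega> A w"
    using edge_support assms by metis
  have e: "e face_of K L C" "aff_dim e = 1" using assms by (auto simp: edges_def edge_of_def)
  have eK: "e \<subseteq> K L C" using e(1) by (rule face_of_imp_subset)
  have w': "w \<in> C'" using support_C' min by blast
  have AC: "A \<in> C" "A + w \<in> C" using w eK K_subset_C by auto
  have "\<omega> A w \<in> \<int>" using w by (auto simp: prim_def intro: L_om)
  moreover have "0 \<le> \<omega> A w" using om_C_C' AC w' by blast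
  moreover have "\<omega> A w \<le> 1" using edge_at_height_le_1 [OF w(1) AC w(3) min] .
  ultimately have d: "\<omega> A w = 0 \<or> \<omega> A w = 1" by (auto elim!: Ints_cases)
  let ?F = "{x \<in> K L C. \<omega> x w = \<omega> A w}"
  have F: "?F face_of K L C" using face_line min by blast
  have sub: "e \<subseteq> ?F" using eK eq by auto
  \<comment> \<open>A one-dimensional face of a one-dimensional convex set is the whole set.\<close>
  have "e face_of ?F" using face_of_subset [OF e(1) sub] by auto
  moreover have "aff_dim ?F = 1"
    by (rule aff_dim_line [of w A]) (use sub w prim_nonzero in auto)
  ultimately have "e = ?F" using face_of_aff_dim_lt [OF face_of_imp_convex [OF F]] e(2) by fastforce
  then have "edge_data w (\<omega> A w) e" unfolding edge_data_def using w w' d min by blast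
  then show ?thesis using that by blast
qed

lemma edge_data_P:
  assumes "edge_data w d e" shows "e \<subseteq> P L C"
proof -
  obtain A where A: "A \<in> L" "A \<in> e" using assms by (auto simp: edge_data_def)
  then have AG: "A \<in> G" using assms K_L_G by (auto simp: edge_data_def)
  obtain k where k: "k \<in> L" "k \<in> Ci" using G_Ci by blast
  then have "A + k \<in> K L C" using G_add [OF AG] Ci_subset G_K by auto
  moreover have "\<omega> (A + k) w > d"
    using om_Ci_C' [OF k(2), of w] A assms prim_nonzero by (auto simp: edge_data_def)
  then have "A + k \<notin> e" using assms by (auto simp: edge_data_def)
  ultimately have "e \<noteq> K L C" by auto
  then have "e \<inter> interior (K L C) = {}" using face_of_disjoint_interior edge_data_face assms by blast
  moreover have "e \<subseteq> K L C" using assms by (auto simp: edge_data_def)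
  ultimately show ?thesis using closure_subset by (auto simp: P_eq)
qed

lemma edge_vector_eq:
  assumes e: "edge_data w d e" shows "edge_vector L ru rv e = w"
proof -
  have w: "prim w" "w \<in> C'" "w \<noteq> 0" using e prim_nonzero by (auto simp: edge_data_def)
  have gw: "0 < g w" using g_pos w by blast
  obtain A where A: "A \<in> L" "A \<in> e" "A + w \<in> e" using e by (auto simp: edge_data_def)
  show ?thesis
    unfolding edge_vector_def primitive_iff
  proof (rule the_equality)
    show "prim w \<and> (\<forall>A\<in>e. \<forall>B\<in>e. before L ru rv A B \<longrightarrow> (\<exists>c>0. B - A = c *\<^sub>R w))"
    proof (intro conjI ballI impI w)
      fix A B assume AB: "A \<in> e" "B \<in> e" "before L ru rv A B"
      then have "\<omega> (B - A) w = 0" using e by (auto simp: edge_data_def)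
      then obtain c where c: "B - A = c *\<^sub>R w" using parallel w by blast
      have "0 < g (B - A)" using AB before_iff by simp
      then have "0 < c * g w" unfolding c by (simp add: algebra_simps)
      then have "c > 0" using gw by (simp add: zero_less_mult_iff)
      then show "\<exists>c>0. B - A = c *\<^sub>R w" using c by blast
    qed
  next
    fix w' assume w': "prim w' \<and> (\<forall>A\<in>e. \<forall>B\<in>e. before L ru rv A B \<longrightarrow> (\<exists>c>0. B - A = c *\<^sub>R w'))"
    have "before L ru rv A (A + w)" using A edge_data_P [OF e] gw unfolding before_iff by auto
    then obtain c where c: "c > 0" "A + w - A = c *\<^sub>R w'" using w' A by blast
    then have "w = c *\<^sub>R w'" by simp
    then show "w' = w" using prim_pos_multiple_eq [of w' w c] c w w' by simp
  qed
qed

text \<open>\<open>e\<close> minimises the form of \<open>w\<close> and \<open>e'\<close> that of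
  \<open>w'\<close>. So Cramer's rule writes \<open>B - A\<close> as a nonnegative combination of
  \<open>w\<close> and \<open>w'\<close>, on both of which \<open>g\<close> is positive.\<close>

lemma edge_beforeI:
  assumes e: "edge_data w d e" and e': "edge_data w' d' e'" and neg: "\<omega> w w' < 0"
  shows "edge_before L ru rv e e'"
  unfolding edge_before_def
proof (intro conjI ballI)
  show "e \<noteq> e'" using edge_vector_eq [OF e] edge_vector_eq [OF e'] neg by auto
  fix A B assume AB: "A \<in> e" "B \<in> e'"
  have 1: "\<omega> (B - A) w \<ge> 0" "\<omega> (B - A) w' \<le> 0" using AB e e' by (auto simp: edge_data_def)
  have gw: "0 < g w" "0 < g w'" using e e' g_pos prim_nonzero by (auto simp: edge_data_def)
  have "(- \<omega> w w') *\<^sub>R x = (- \<omega> x w') *\<^sub>R w + \<omega> x w *\<^sub>R w'" for x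
    using cramer [of w w' x] anti [of w x] by simp
  then have eq: "(- \<omega> w w') *\<^sub>R (B - A) = (- \<omega> (B - A) w') *\<^sub>R w + \<omega> (B - A) w *\<^sub>R w'" .
  show "A = B \<or> before L ru rv A B"
  proof (cases "A = B")
    case False
    have nz: "\<omega> (B - A) w > 0 \<or> \<omega> (B - A) w' < 0"
    proof (rule ccontr)
      assume "\<not> ?thesis"
      then have "\<omega> (B - A) w = 0" "\<omega> (B - A) w' = 0" using 1 by linarith+
      then have "(- \<omega> w w') *\<^sub>R (B - A) = 0" unfolding eq by (simp del: om_simps)
      then show False using neg False by simp
    qed
    have "(- \<omega> w w') * g (B - A) = (- \<omega> (B - A) w') * g w + \<omega> (B - A) w * g w'"
      using arg_cong [OF eq, of g] by (simp add: algebra_simps)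
    also have "\<dots> > 0" using nz 1 gw
      by (intro pos_combination) linarith+
    finally have "g (B - A) > 0" using neg by (simp only: zero_less_mult_iff) linarith
    then show ?thesis using AB edge_data_P e e' unfolding before_iff by fastforce
  qed simp
qed

lemma edge_data_not_parallel:
  assumes e: "edge_data w d e" and e': "edge_data w' d' e'" and "e \<noteq> e'"
  shows "\<omega> w w' \<noteq> 0"
proof
  assume "\<omega> w w' = 0"
  have w: "prim w" "prim w'" "w' \<noteq> 0" "0 < g w" "0 < g w'"
    using e e' g_pos prim_nonzero by (auto simp: edge_data_def)
  obtain t where t: "w = t *\<^sub>R w'" using parallel \<open>\<omega> w w' = 0\<close> w(3) by blast
  then have "g w = t * g w'" by (simp add: algebra_simps)
  then have "t > 0" using w by (simp add: zero_less_mult_iff)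
  then have "w = w'" using prim_pos_multiple_eq w t by blast
  then show False using edge_data_unique e e' assms(3) by blast
qed

section \<open>Vertices of the supplementary cone\<close>

definition G' where "G' = C' \<inter> (L - {0})"

lemma dual_C: "lattice_cone.C (\<lambda>x y. - \<omega> x y) (- u) v = C'"
proof -
  interpret d: lattice_cone L "\<lambda>x y. - \<omega> x y" c b "- u" v by (rule dual)
  show ?thesis unfolding d.C_def C'_def using anti [of v] by auto
qed

lemma K'_eq: "K L C' = convex hull G'"
  by (simp add: K_def G'_def)

lemma G'_K': "p \<in> G' \<Longrightarrow> p \<in> K L C'"
  by (simp add: K'_eq hull_inc)

lemma K'_ge:
  assumes "linear f" "\<And>p. p \<in> G' \<Longrightarrow> m \<le> f p" "p \<in> K L C'" shows "m \<le> (f p :: real)"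
proof -
  interpret d: lattice_cone L "\<lambda>x y. - \<omega> x y" c b "- u" v by (rule dual)
  show ?thesis using d.K_ge [of f m p] assms by (simp add: d.G_def dual_C G'_def)
qed

lemma om_Ci_K'_ge_1:
  assumes "A \<in> Ci" "A \<in> L" "p \<in> K L C'" shows "1 \<le> \<omega> A p"
proof (rule K'_ge [OF linear_om_right _ assms(3)])
  fix q assume "q \<in> G'"
  then show "1 \<le> \<omega> A q" using om_Ci_C' [OF assms(1)] L_om_pos [OF assms(2)] by (auto simp: G'_def)
qed

lemma dual_vertexI:
  assumes w: "w \<in> C'" "w \<in> L" and A: "A \<in> L" "A \<in> Ci" "A + w \<in> Ci" and "\<omega> A w = 1"
  shows "w \<in> vertices L C'"
  unfolding vertices_def mem_Collect_eq extreme_point_of_def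
proof (intro conjI ballI notI)
  have "w \<noteq> 0" using assms by auto
  then show "w \<in> K L C'" using w by (intro G'_K') (auto simp: G'_def)
  fix p q assume pq: "p \<in> K L C'" "q \<in> K L C'" "w \<in> open_segment p q"
  have AwL: "A + w \<in> L" using A w by (intro L_add)
  have "\<omega> A p = 1 \<and> \<omega> A q = 1"
    using linear_min_open_segment [OF pq(3) linear_om_right] om_Ci_K'_ge_1 A pq assms by metis
  moreover have "\<omega> (A + w) w = 1" using assms by simp
  then have "\<omega> (A + w) p = 1 \<and> \<omega> (A + w) q = 1"
    using linear_min_open_segment [OF pq(3) linear_om_right] om_Ci_K'_ge_1 [OF A(3) AwL] pq by metis
  \<comment> \<open>Subtracting the equalities gives \<open>\<omega> w p = 0\<close>; together with
    \<open>\<omega> A p = 1\<close> this determines \<open>p\<close>, and likewise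
    \<open>q\<close>.\<close>
  ultimately have "\<omega> A p = 1" "\<omega> p w = 0" "\<omega> A q = 1" "\<omega> q w = 0"
    using anti [of w p] anti [of w q] by auto
  then have "p = w" "q = w"
    using lattice_basis [OF assms(6), of p] lattice_basis [OF assms(6), of q] by auto
  then show False using pq by simp
qed

lemma dual_not_vertexI:
  assumes "p \<in> G'" "q \<in> G'" "p \<noteq> q" "p + q = 2 *\<^sub>R w" shows "w \<notin> vertices L C'"
proof -
  have "w = (1/2) *\<^sub>R (p + q)" using assms(4) by simp
  then have "w \<in> open_segment p q" using assms(3)
    unfolding in_segment by (auto intro!: exI [of _ "1/2"] simp: scaleR_add_right)
  then show ?thesis using assms(1,2) G'_K' by (auto simp: vertices_def extreme_point_of_def)
qed

lemma dual_vertex_G': "w \<in> vertices L C' \<Longrightarrow> w \<in> G'"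
  unfolding vertices_def K'_eq using extreme_point_of_convex_hull by blast

text \<open>For \<open>d = 1\<close> the form takes positive integer values on \<open>G\<close>,
  because \<open>w\<close> is interior to the dual cone; for \<open>d = 0\<close> nonnegativity is
  enough.\<close>

lemma edge_dataI:
  assumes "prim w" "w \<in> C'" "A \<in> L" "A \<in> C" "A + w \<in> C" "A \<noteq> 0" "A + w \<noteq> 0" "\<omega> A w = d"
    and "d = 0 \<or> d = 1 \<and> w \<in> C'i"
  shows "edge_data w d {x \<in> K L C. \<omega> x w = d}"
proof -
  have wL: "w \<in> L" using assms by (simp add: prim_def)
  have "d \<le> \<omega> x w" if x: "x \<in> G" for x
  proof -
    have x': "x \<in> C" "x \<noteq> 0" "x \<in> L" using x by (auto simp: G_def)
    show ?thesis
      using assms(9) om_C_C' [OF x'(1) assms(2)] om_C_C'i [OF x'(1,2)] L_om_pos [OF x'(3) wL] by auto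
  qed
  then have min: "\<forall>x\<in>K L C. d \<le> \<omega> x w" using K_ge [OF linear_om_left] by blast
  have "A \<in> K L C" "A + w \<in> K L C" using assms wL L_add by (auto intro!: G_K simp: G_def)
  then show ?thesis unfolding edge_data_def using assms min by auto
qed

lemma dual_vertex_edge:
  assumes "w \<in> vertices L C'" obtains d e where "edge_data w d e"
proof -
  have w: "w \<in> C'" "w \<in> L" "w \<noteq> 0" using dual_vertex_G' assms by (auto simp: G'_def)
  obtain w1 k where k: "prim w1" "k \<ge> (1::int)" "w = of_int k *\<^sub>R w1" using prim_multiple w by metis
  have w1: "w1 \<in> C'" using w k by (auto simp: C'_def zero_le_mult_iff)
  have mult: "of_int j *\<^sub>R w1 \<in> G'" if "j \<ge> 1" for j :: int
    using that w1 k(1) prim_nonzero [OF k(1)] by (auto simp: G'_def C'_def prim_def intro: L_scale)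
  have "k = 1"
  proof (rule ccontr)
    assume "k \<noteq> 1"
    \<comment> \<open>\<open>w\<close> would be the midpoint of \<open>(k - 1) w1\<close> and
      \<open>(k + 1) w1\<close>.\<close>
    then have "w \<notin> vertices L C'"
      using k prim_nonzero [OF k(1)]
      by (intro dual_not_vertexI [OF mult [of "k - 1"] mult [of "k + 1"]])
        (auto simp: scaleR_add_left [symmetric])
    then show False using assms by simp
  qed
  then have prim: "prim w" using k by simp
  have C0: "0 \<le> \<omega> u w" "0 \<le> \<omega> v w" using w by (auto simp: C'_def)
  consider "\<omega> u w = 0" | "\<omega> v w = 0" | "0 < \<omega> u w" "0 < \<omega> v w" using C0 by linarith
  then show ?thesis
  proof cases
    case 1
    have "edge_data w 0 {x \<in> K L C. \<omega> x w = 0}"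
    \<comment> \<open>Here \<open>- w\<close> lies on the ray of \<open>u\<close>. Starting at
      \<open>- w\<close> would make the next point the origin, hence the start at
      \<open>- 2 w\<close>.\<close>
    proof (rule edge_dataI [OF prim w(1), of "(- 2) *\<^sub>R w"])
      have eq: "(- 2) *\<^sub>R w + w = - w" by (simp add: scaleR_2)
      show "(- 2) *\<^sub>R w + w \<in> C" "(- 2) *\<^sub>R w + w \<noteq> 0"
        unfolding eq using w 1 C0 anti [of w v] by (auto simp: C_def)
      show "(- 2) *\<^sub>R w \<in> L" by (rule L_scale) (use w in auto)
    qed (use w 1 C0 anti [of w v] in \<open>auto simp: C_def\<close>)
    then show ?thesis using that by blast
  next
    case 2
    have "edge_data w 0 {x \<in> K L C. \<omega> x w = 0}"
      by (rule edge_dataI [OF prim w(1), of w])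
        (use w 2 C0 anti [of w v] in \<open>auto simp: C_def scaleR_2 [symmetric]\<close>)
    then show ?thesis using that by blast
  next
    case 3
    obtain y where y: "y \<in> L" "\<omega> y w = 1" using prim by (auto simp: prim_def)
    \<comment> \<open>The least integer for which \<open>y + k w\<close> is on the inner side of the
      line of \<open>u\<close>.\<close>
    define k where "k = \<lceil>- \<omega> u y / \<omega> u w\<rceil>"
    have "of_int k \<ge> - \<omega> u y / \<omega> u w" "of_int k - 1 < - \<omega> u y / \<omega> u w" by (auto simp: k_def) linarith
    then have kb: "- \<omega> u y \<le> of_int k * \<omega> u w" "(of_int k - 1) * \<omega> u w < - \<omega> u y"
      using 3 by (simp_all only: pos_divide_le_eq pos_less_divide_eq)
    define A where "A = y + of_int k *\<^sub>R w"
    have A: "A \<in> L" "\<omega> A w = 1" "0 \<le> \<omega> u A" "\<omega> u (A - w) < 0"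
      using y kb w by (auto simp: A_def algebra_simps intro!: L_add L_scale)
    have "0 \<le> \<omega> (A + w) v"
    proof (rule ccontr)
      assume neg: "\<not> 0 \<le> \<omega> (A + w) v"
      \<comment> \<open>\<open>A - w\<close> is beyond the line of \<open>u\<close>; the identity
        puts it strictly on the inner side of the line of \<open>v\<close>. Hence
        \<open>w - A\<close> is in \<open>C'\<close>.\<close>
      have "\<omega> u v * \<omega> (A - w) w = \<omega> (A - w) v * \<omega> u w + \<omega> u (A - w) * \<omega> v w" by (rule om_decomp)
      then have "\<omega> u v = \<omega> (A - w) v * \<omega> u w + \<omega> u (A - w) * \<omega> v w" using A by simp
      moreover have "\<omega> u (A - w) * \<omega> v w < 0" using A 3 by (intro mult_neg_pos)
      ultimately have "0 < \<omega> (A - w) v * \<omega> u w" using D by linarith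
      then have pos: "0 < \<omega> (A - w) v" using 3 by (simp add: zero_less_mult_iff)
      have o: "\<omega> (A + w) w = 1" "\<omega> (w - A) w = - 1" using A(2) by simp_all
      have nz: "A + w \<noteq> 0" "w - A \<noteq> 0" "A + w \<noteq> w - A"
      proof -
        show "A + w \<noteq> 0" using o(1) by (intro notI) (simp del: om_simps(1,3))
        show "w - A \<noteq> 0" using o(2) by (intro notI) (simp del: om_simps(1,3))
        show "A + w \<noteq> w - A" using arg_cong [of "A + w" "w - A" "\<lambda>x. \<omega> x w"] o by auto
      qed
      have "A + w \<in> G'" using nz A(1,3) w 3 neg anti [of v A] anti [of v w]
        by (auto simp: G'_def C'_def intro: L_add)
      moreover have "w - A \<in> G'" using nz A(1,4) w pos anti [of v A] anti [of v w]
        by (auto simp: G'_def C'_def intro: L_diff)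
      ultimately have "w \<notin> vertices L C'"
        by (rule dual_not_vertexI [OF _ _ nz(3)]) (simp add: scaleR_2)
      then show False using assms by simp
    qed
    then have "A + w \<in> C" "A \<in> C" using A 3 anti [of w v] by (auto simp: C_def)
    moreover have "A \<noteq> 0" using A(2) by auto
    moreover have "A + w \<noteq> 0" using A(2) by (auto simp: add_eq_0_iff)
    ultimately have "edge_data w 1 {x \<in> K L C. \<omega> x w = 1}"
      using A 3 w by (intro edge_dataI [OF prim w(1), of A]) (auto simp: C'i_def)
    then show ?thesis using that by blast
  qed
qed

text \<open>On level 0, \<open>w\<close> lies on one of the two lines bounding the cone. A far shift
  along it brings two consecutive lattice points of the line \<open>\<omega> x w = 1\<close> into
  \<open>Ci\<close>, as \<open>dual_vertexI\<close> requires.\<close>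

lemma edge_data_0_vertex:
  assumes e: "edge_data w 0 e" shows "w \<in> vertices L C'"
proof -
  have w: "prim w" "w \<in> C'" "w \<in> L" "w \<noteq> 0" using e prim_nonzero by (auto simp: edge_data_def prim_def)
  obtain A where A: "A \<in> L" "A \<in> K L C" "\<omega> A w = 0" using e by (auto simp: edge_data_def)
  then have AC: "A \<in> C" "A \<noteq> 0" using K_L_G by (auto simp: G_def)
  have C0: "0 \<le> \<omega> u w" "0 \<le> \<omega> v w" using w by (auto simp: C'_def)
  have "w \<notin> C'i" using om_C_C'i AC A(3) by force
  then have bd: "\<omega> u w = 0 \<or> \<omega> v w = 0" using C0 by (auto simp: C'i_def)
  obtain y where y: "y \<in> L" "\<omega> y w = 1" using w by (auto simp: prim_def)
  have Dy: "\<omega> u v = \<omega> y v * \<omega> u w + \<omega> u y * \<omega> v w" using om_decomp [of y w] y by simp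
  show ?thesis
  proof (cases "\<omega> u w = 0")
    case True
    then have vw: "0 < \<omega> v w" "0 < \<omega> u y" using Dy D C0 by (auto simp: zero_less_mult_iff)
    obtain k :: nat where k: "\<bar>\<omega> y v\<bar> < real k * \<omega> v w" using vw reals_Archimedean3 by blast
    \<comment> \<open>\<open>Suc k\<close> leaves room for \<open>A + w\<close>, which is the shift
      by \<open>k\<close>.\<close>
    define A where "A = y - real (Suc k) *\<^sub>R w"
    have "A + w = y - real k *\<^sub>R w" by (simp add: A_def algebra_simps)
    moreover have "y - real k *\<^sub>R w \<in> Ci" using vw k True anti [of w v] by (auto simp: Ci_def)
    moreover have "A \<in> Ci" using vw k True anti [of w v] by (auto simp: Ci_def A_def algebra_simps)
    moreover have "A \<in> L" "\<omega> A w = 1" using y w by (auto simp: A_def intro!: L_diff L_scale)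
    ultimately show ?thesis using w by (intro dual_vertexI) auto
  next
    case False
    then have vw: "\<omega> v w = 0" "0 < \<omega> u w" "0 < \<omega> y v" using Dy D C0 bd by (auto simp: zero_less_mult_iff)
    obtain k :: nat where k: "\<bar>\<omega> u y\<bar> < real k * \<omega> u w" using vw reals_Archimedean3 by blast
    define A where "A = y + real k *\<^sub>R w"
    have "A \<in> Ci" "A + w \<in> Ci" using vw k anti [of w v] by (auto simp: Ci_def A_def algebra_simps)
    moreover have "A \<in> L" "\<omega> A w = 1" using y w by (auto simp: A_def intro!: L_add L_scale)
    ultimately show ?thesis using w by (intro dual_vertexI) auto
  qed
qed

text \<open>If \<open>w\<close> were on an edge of \<open>C'\<close>, then \<open>w\<close> or
  \<open>- w\<close> would be a point of \<open>G\<close> on level 0.\<close>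

lemma edge_data_1_C'i:
  assumes e: "edge_data w 1 e" shows "w \<in> C'i"
proof -
  have w: "w \<in> C'" "w \<in> L" "w \<noteq> 0" using e prim_nonzero by (auto simp: edge_data_def prim_def)
  have min: "1 \<le> \<omega> x w" if "x \<in> G" for x using that e G_K by (auto simp: edge_data_def)
  have C0: "0 \<le> \<omega> u w" "0 \<le> \<omega> v w" using w by (auto simp: C'_def)
  have "\<omega> u w \<noteq> 0"
  proof
    assume "\<omega> u w = 0"
    then have "- w \<in> G" using w C0 anti [of w v] by (auto simp: G_def C_def)
    then show False using min [of "- w"] by simp
  qed
  moreover have "\<omega> v w \<noteq> 0"
  proof
    assume "\<omega> v w = 0"
    then have "w \<in> G" using w C0 anti [of w v] by (auto simp: G_def C_def)
    then show False using min [of w] by simp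
  qed
  ultimately show ?thesis using C0 by (auto simp: C'i_def)
qed

text \<open>\<open>A\<close> is the first and \<open>A + n w\<close> the last lattice point of the bounded edge \<open>e\<close>.\<close>

definition edge_points :: "'a \<Rightarrow> 'a set \<Rightarrow> 'a \<Rightarrow> nat \<Rightarrow> bool" where
  "edge_points w e A n \<longleftrightarrow> n \<ge> 1 \<and> A \<in> L \<and> \<omega> A w = 1 \<and> w \<in> L \<and> 0 < \<omega> u w \<and> \<omega> w v < 0 \<and>
     0 \<le> \<omega> u A \<and> \<omega> u (A - w) < 0 \<and> 0 \<le> \<omega> (A + real n *\<^sub>R w) v \<and> \<omega> (A + real (Suc n) *\<^sub>R w) v < 0 \<and>
     e = closed_segment A (A + real n *\<^sub>R w) \<and> e \<inter> L = (\<lambda>k. A + real k *\<^sub>R w) ` {..n}"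

lemma edge_pointsE:
  assumes e: "edge_data w 1 e" obtains A n where "edge_points w e A n"
proof -
  have w: "prim w" "w \<in> L" "w \<noteq> 0" using e prim_nonzero by (auto simp: edge_data_def prim_def)
  have wi: "0 < \<omega> u w" "\<omega> w v < 0" using edge_data_1_C'i [OF e] anti [of w v] by (auto simp: C'i_def)
  have ee: "e = {x \<in> K L C. \<omega> x w = 1}" using e by (simp add: edge_data_def)
  obtain A0 where A0: "A0 \<in> L" "A0 \<in> e" "A0 + w \<in> e" using e by (auto simp: edge_data_def)
  have A0C: "A0 \<in> C" "A0 + w \<in> C" "\<omega> A0 w = 1" using A0 ee K_subset_C by auto
  \<comment> \<open>Along \<open>w\<close> the form \<open>\<omega> u\<close> increases and pairing
    with \<open>v\<close> decreases, so \<open>A0 + k w\<close> is in the cone exactly for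
    \<open>k\<close> from \<open>i\<close> to \<open>j\<close>.\<close>
  define i where "i = \<lceil>- \<omega> u A0 / \<omega> u w\<rceil>"
  define j where "j = \<lfloor>\<omega> A0 v / - \<omega> w v\<rfloor>"
  have C_iff: "A0 + of_int k *\<^sub>R w \<in> C \<longleftrightarrow> i \<le> k \<and> k \<le> j" for k :: int
  proof -
    have "i \<le> k \<longleftrightarrow> - \<omega> u A0 / \<omega> u w \<le> of_int k" by (simp add: i_def ceiling_le_iff)
    also have "\<dots> \<longleftrightarrow> 0 \<le> \<omega> u (A0 + of_int k *\<^sub>R w)" using wi by (subst pos_divide_le_eq) auto
    finally have 1: "i \<le> k \<longleftrightarrow> 0 \<le> \<omega> u (A0 + of_int k *\<^sub>R w)" .
    have "k \<le> j \<longleftrightarrow> of_int k \<le> \<omega> A0 v / - \<omega> w v" by (simp add: j_def le_floor_iff)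
    also have "\<dots> \<longleftrightarrow> of_int k * - \<omega> w v \<le> \<omega> A0 v" using wi by (intro pos_le_divide_eq) simp
    also have "\<dots> \<longleftrightarrow> 0 \<le> \<omega> (A0 + of_int k *\<^sub>R w) v" by simp linarith
    finally show ?thesis using 1 by (simp add: C_def)
  qed
  have i0: "i \<le> 0" "1 \<le> j" using C_iff [of 0] C_iff [of 1] A0C by auto
  define A where "A = A0 + of_int i *\<^sub>R w"
  define n where "n = nat (j - i)"
  have ni: "of_int j = of_int i + real n" "n \<ge> 1" using i0 by (auto simp: n_def)
  have An: "A + real n *\<^sub>R w = A0 + of_int j *\<^sub>R w" using ni by (simp add: A_def algebra_simps)
  have AL: "A \<in> L" using A0 w by (auto simp: A_def intro!: L_add L_scale)
  have Ak: "A + real k *\<^sub>R w = A0 + of_int (i + int k) *\<^sub>R w" for k by (simp add: A_def algebra_simps)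
  have in_e: "A + real k *\<^sub>R w \<in> e" if "k \<le> n" for k
  proof -
    have "A + real k *\<^sub>R w \<in> C" unfolding Ak C_iff using that ni by linarith
    moreover have "A + real k *\<^sub>R w \<in> L" using AL w by (auto intro!: L_add L_scale)
    moreover have o: "\<omega> (A + real k *\<^sub>R w) w = 1" using A0C by (simp add: A_def)
    then have "A + real k *\<^sub>R w \<noteq> 0" by (metis om_simps(7) zero_neq_one)
    ultimately show ?thesis using o by (auto simp: ee intro!: G_K simp: G_def)
  qed
  have eL: "e \<inter> L = (\<lambda>k. A + real k *\<^sub>R w) ` {..n}"
  proof
    show "e \<inter> L \<subseteq> (\<lambda>k. A + real k *\<^sub>R w) ` {..n}"
    proof
      fix x assume x: "x \<in> e \<inter> L"
      then have xC: "x \<in> C" "\<omega> (x - A0) w = 0" using ee K_subset_C A0C by auto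
      then obtain t where t: "x - A0 = t *\<^sub>R w" using parallel w by blast
      have "t *\<^sub>R w \<in> L" using x A0 L_diff unfolding t [symmetric] by blast
      then obtain k :: int where k: "t = of_int k" using prim_scale_Ints w by (auto elim!: Ints_cases)
      then have xk: "x = A0 + of_int k *\<^sub>R w" using t by (simp add: algebra_simps)
      then have ik: "i \<le> k" "k \<le> j" using C_iff xC by auto
      have "x = A + real (nat (k - i)) *\<^sub>R w" using ik by (simp add: xk A_def algebra_simps)
      moreover have "nat (k - i) \<le> n" using ik by (simp add: n_def)
      ultimately show "x \<in> (\<lambda>k. A + real k *\<^sub>R w) ` {..n}" by blast
    qed
    show "(\<lambda>k. A + real k *\<^sub>R w) ` {..n} \<subseteq> e \<inter> L"
      using in_e AL w by (auto intro!: L_add L_scale)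
  qed
  have "e = closed_segment A (A + real n *\<^sub>R w)"
  proof
    have "x \<in> closed_segment A (A + real n *\<^sub>R w)" if x: "x \<in> e \<inter> L" for x
    proof -
      obtain k where k: "k \<le> n" "x = A + real k *\<^sub>R w" using x unfolding eL by auto
      have "x = (1 - real k / real n) *\<^sub>R A + (real k / real n) *\<^sub>R (A + real n *\<^sub>R w)"
        using k ni by (simp add: algebra_simps)
      moreover have "0 \<le> real k / real n" "real k / real n \<le> 1" using k ni by auto
      ultimately show ?thesis unfolding in_segment by blast
    qed
    \<comment> \<open>Lattice points suffice, because a face is the hull of those it
      contains.\<close>
    then have "convex hull (e \<inter> G) \<subseteq> closed_segment A (A + real n *\<^sub>R w)"
      by (intro hull_minimal convex_closed_segment) (auto simp: G_def)
    then show "e \<subseteq> closed_segment A (A + real n *\<^sub>R w)"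
      using face_subset_hull [OF edge_data_face [OF e]] by blast
    show "closed_segment A (A + real n *\<^sub>R w) \<subseteq> e"
      using in_e [of 0] in_e [of n] face_of_imp_convex [OF edge_data_face [OF e]]
      by (intro closed_segment_subset) auto
  qed
  moreover have "A \<in> C" "A + real n *\<^sub>R w \<in> C" using in_e [of 0] in_e [of n] ee K_subset_C by auto
  then have AC: "0 \<le> \<omega> u A" "0 \<le> \<omega> (A + real n *\<^sub>R w) v" by (auto simp: C_def)
  moreover have "\<omega> u (A - w) < 0"
  proof -
    have "A - w = A0 + of_int (i - 1) *\<^sub>R w" by (simp add: A_def algebra_simps)
    then have "A - w \<notin> C" using C_iff [of "i - 1"] by simp
    \<comment> \<open>Going back along \<open>w\<close> increases the pairing with \<open>v\<close>,
      so \<open>A - w\<close> can leave the cone only across the line of \<open>u\<close>.\<close>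
    moreover have "\<omega> (A - w) v \<ge> 0"
    proof -
      have "\<omega> (A - w) v = \<omega> (A + real n *\<^sub>R w) v + (1 + real n) * (- \<omega> w v)" by (simp add: algebra_simps)
      also have "\<dots> \<ge> 0" using AC(2) wi by (intro add_nonneg_nonneg mult_nonneg_nonneg) auto
      finally show ?thesis .
    qed
    ultimately show ?thesis by (simp add: C_def)
  qed
  moreover have "\<omega> (A + real (Suc n) *\<^sub>R w) v < 0"
  proof -
    have "A + real (Suc n) *\<^sub>R w = A0 + of_int (j + 1) *\<^sub>R w" using An by (simp add: algebra_simps)
    then have "A + real (Suc n) *\<^sub>R w \<notin> C" using C_iff [of "j + 1"] by simp
    moreover have "\<omega> u (A + real (Suc n) *\<^sub>R w) \<ge> 0"
    proof -
      have "\<omega> u (A + real (Suc n) *\<^sub>R w) = \<omega> u A + real (Suc n) * \<omega> u w" by simp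
      also have "\<dots> \<ge> 0" using AC(1) wi by (intro add_nonneg_nonneg mult_nonneg_nonneg) auto
      finally show ?thesis .
    qed
    ultimately show ?thesis by (simp add: C_def)
  qed
  moreover have "\<omega> A w = 1" using A0C by (simp add: A_def)
  ultimately have "edge_points w e A n" unfolding edge_points_def using ni AL w wi eL by blast
  then show ?thesis using that by blast
qed

lemma edge_points_int_length:
  assumes "edge_points w e A n" shows "int_length L e = n"
proof -
  have "w \<noteq> 0" "e \<inter> L = (\<lambda>k. A + real k *\<^sub>R w) ` {..n}" using assms by (auto simp: edge_points_def)
  moreover have "inj_on (\<lambda>k. A + real k *\<^sub>R w) {..n}" using \<open>w \<noteq> 0\<close> by (auto simp: inj_on_def)
  ultimately show ?thesis by (simp add: int_length_def card_image)
qed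

text \<open>By monotonicity along \<open>w\<close>, only the first point can lie on the ray of
  \<open>u\<close> and only the last on the ray of \<open>v\<close>.\<close>

lemma edge_points_Ci:
  assumes "edge_points w e A n" "0 < k \<or> 0 < \<omega> u A" "k < n \<or> k = n \<and> 0 < \<omega> (A + real n *\<^sub>R w) v"
  shows "A + real k *\<^sub>R w \<in> Ci"
proof -
  have h: "0 \<le> \<omega> u A" "0 < \<omega> u w" "\<omega> w v < 0" "0 \<le> \<omega> (A + real n *\<^sub>R w) v"
    using assms(1) by (auto simp: edge_points_def)
  have "0 < \<omega> u A + real k * \<omega> u w" using assms(2) h by (auto intro: add_nonneg_pos add_pos_nonneg)
  moreover have "\<omega> (A + real k *\<^sub>R w) v = \<omega> (A + real n *\<^sub>R w) v + (real n - real k) * - \<omega> w v"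
    by (simp add: algebra_simps)
  moreover have "0 < \<omega> (A + real n *\<^sub>R w) v + (real n - real k) * - \<omega> w v"
    using assms(3)
  proof
    assume "k < n"
    then have "0 < (real n - real k) * - \<omega> w v" using h by (intro mult_pos_pos) auto
    then show ?thesis using h by linarith
  qed auto
  ultimately show ?thesis by (simp add: Ci_def)
qed

section \<open>End edges\<close>

lemma rational_ruI:
  assumes "A \<in> L" "A \<noteq> 0" "\<omega> u A = 0" "0 \<le> \<omega> A v" shows "rational L ru"
proof -
  have "A \<in> ru" unfolding ru_iff using assms by blast
  then show ?thesis unfolding rational_def using assms by blast
qed

lemma rational_rvI:
  assumes "A \<in> L" "A \<noteq> 0" "\<omega> A v = 0" "0 \<le> \<omega> u A" shows "rational L rv"
proof -
  have "A \<in> rv" unfolding rv_iff using assms by blast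
  then show ?thesis unfolding rational_def using assms by blast
qed

lemma rational_ruE:
  assumes "rational L ru" obtains a where "prim a" "\<omega> u a = 0" "0 < \<omega> a v"
proof -
  obtain z where z: "z \<in> L" "z \<in> ru" "z \<noteq> 0" using assms unfolding rational_def by blast
  then obtain a k where a: "prim a" "k \<ge> (1::int)" "z = of_int k *\<^sub>R a" using prim_multiple by blast
  have "\<omega> u z = 0" "0 \<le> \<omega> z v" using z(2) unfolding ru_iff by auto
  then have "\<omega> u a = 0" "0 \<le> \<omega> a v" using a by (auto simp: zero_le_mult_iff)
  moreover have "\<omega> a v \<noteq> 0" using cone_eqI [of a 0] \<open>\<omega> u a = 0\<close> prim_nonzero [OF a(1)] by auto
  ultimately show ?thesis using that a by simp
qed

lemma ru_multiple:
  assumes a: "prim a" "\<omega> u a = 0" "0 < \<omega> a v"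
    and x: "x \<in> L" "x \<noteq> 0" "\<omega> u x = 0" "0 \<le> \<omega> x v"
  obtains t where "x = t *\<^sub>R a" "t \<ge> 1"
proof -
  have "x = (\<omega> x v / \<omega> a v) *\<^sub>R a" using a x by (intro cone_eqI) auto
  moreover have "\<omega> x v \<noteq> 0" using cone_eqI [of x 0] x by auto
  ultimately obtain t where t: "x = t *\<^sub>R a" "t > 0" using x a
    by (metis divide_pos_pos less_eq_real_def)
  then have "t \<in> \<int>" using prim_scale_Ints a x by blast
  then have "t \<ge> 1" using t by (auto elim!: Ints_cases)
  then show ?thesis using that t by blast
qed

lemma end_point_eq:
  assumes a: "prim a" "\<omega> u a = 0" "0 < \<omega> a v" shows "end_point L ru = a"
proof -
  have a0: "a \<in> L" "a \<noteq> 0" "a \<in> ru" unfolding ru_iff using a prim_nonzero by (auto simp: prim_def)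
  have mult: "\<exists>t\<ge>1. x = t *\<^sub>R a" if "x \<in> ru \<inter> L - {0}" for x
  proof -
    have "x \<in> ru" using that by blast
    then have "\<omega> u x = 0" "0 \<le> \<omega> x v" unfolding ru_iff by auto
    then show ?thesis using ru_multiple [OF a, of x] that by blast
  qed
  have le: "norm a \<le> norm x" if "x \<in> ru \<inter> L - {0}" for x
  proof -
    obtain t where "t \<ge> 1" "x = t *\<^sub>R a" using mult \<open>x \<in> ru \<inter> L - {0}\<close> by blast
    then show ?thesis using mult_right_mono [of 1 t "norm a"] by simp
  qed
  show ?thesis unfolding end_point_def
  proof (rule the_equality)
    show "a \<in> ru \<inter> L - {0} \<and> (\<forall>B\<in>ru \<inter> L - {0}. norm a \<le> norm B)" using a0 le by blast
    fix x assume x: "x \<in> ru \<inter> L - {0} \<and> (\<forall>B\<in>ru \<inter> L - {0}. norm x \<le> norm B)"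
    then obtain t where t: "t \<ge> 1" "x = t *\<^sub>R a" using mult by blast
    have "norm x \<le> norm a" using x a0 by blast
    then have "t * norm a \<le> 1 * norm a" using t by simp
    then have "t \<le> 1" using a0(2) by (simp only: mult_le_cancel_right) auto
    then show "x = a" using t by simp
  qed
qed

lemma left_edge_exists:
  assumes a: "prim a" "\<omega> u a = 0" "0 < \<omega> a v" obtains w e where "edge_data w 1 e" "a \<in> e"
proof -
  have aL: "a \<in> L" "a \<noteq> 0" using a prim_nonzero by (auto simp: prim_def)
  obtain x where x: "x \<in> L" "\<omega> x a = 1" using a by (auto simp: prim_def)
  \<comment> \<open>The least multiple of \<open>a\<close> that brings \<open>a + w\<close> back
    across the line of \<open>v\<close>; minimality leaves \<open>w\<close> strictly beyond
    it.\<close>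
  define k where "k = \<lceil>- \<omega> (a - x) v / \<omega> a v\<rceil>"
  have "of_int k \<ge> - \<omega> (a - x) v / \<omega> a v" "of_int k - 1 < - \<omega> (a - x) v / \<omega> a v"
    by (auto simp: k_def simp del: om_simps) linarith
  then have kb: "- \<omega> (a - x) v \<le> of_int k * \<omega> a v" "(of_int k - 1) * \<omega> a v < - \<omega> (a - x) v"
    using a by (simp_all only: pos_divide_le_eq pos_less_divide_eq)
  define w where "w = of_int k *\<^sub>R a - x"
  have wL: "w \<in> L" using x aL by (auto simp: w_def intro!: L_diff L_scale)
  have aw: "\<omega> a w = 1" using x anti [of a x] by (simp add: w_def)
  have w1: "0 \<le> \<omega> (a + w) v" "\<omega> w v < 0" using kb by (auto simp: w_def algebra_simps)
  have "\<omega> u v = \<omega> a v * \<omega> u w" using om_decomp [of a w] aw a by simp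
  then have uw: "0 < \<omega> u w" using D a by (simp add: zero_less_mult_iff)
  have "w \<in> C'i" using uw w1 anti [of v w] by (simp add: C'i_def)
  moreover have "w \<in> C'" using uw w1 anti [of v w] by (simp add: C'_def)
  moreover have "prim w" using wL aw aL by (auto simp: prim_def)
  moreover have "a \<in> C" "a + w \<in> C" using a w1 uw by (auto simp: C_def)
  moreover have "\<omega> (a + w) w = 1" using aw by simp
  then have "a + w \<noteq> 0" by (metis om_simps(7) zero_neq_one)
  ultimately have "edge_data w 1 {x \<in> K L C. \<omega> x w = 1}"
    using aL aw by (intro edge_dataI [of w a]) auto
  moreover have "a \<in> {x \<in> K L C. \<omega> x w = 1}" using \<open>a \<in> C\<close> aL aw by (auto intro!: G_K simp: G_def)
  ultimately show ?thesis using that by blast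
qed

lemma edge_points_first:
  assumes "edge_points w e A n" "x \<in> e" "x \<in> L" "\<omega> u x = 0" shows "x = A"
proof -
  have "x \<in> (\<lambda>k. A + real k *\<^sub>R w) ` {..n}" using assms unfolding edge_points_def by blast
  then obtain k where k: "x = A + real k *\<^sub>R w" by blast
  have h: "0 \<le> \<omega> u A" "0 < \<omega> u w" using assms(1) by (auto simp: edge_points_def)
  have "\<omega> u A + real k * \<omega> u w = 0" using assms(4) k by simp
  moreover have "0 < real k * \<omega> u w" if "k > 0" using h that by simp
  ultimately have "k = 0" using h by fastforce
  then show ?thesis using k by simp
qed

lemma edge_points_last:
  assumes "edge_points w e A n" "x \<in> e" "x \<in> L" "\<omega> x v = 0" shows "x = A + real n *\<^sub>R w"
proof -
  have "x \<in> (\<lambda>k. A + real k *\<^sub>R w) ` {..n}" using assms unfolding edge_points_def by blast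
  then obtain k where k: "x = A + real k *\<^sub>R w" "k \<le> n" by blast
  have "\<not> k < n"
  proof
    assume "k < n"
    have h: "0 \<le> \<omega> (A + real n *\<^sub>R w) v" "\<omega> w v < 0" using assms(1) by (auto simp: edge_points_def)
    have "\<omega> x v = \<omega> (A + real n *\<^sub>R w) v + (real n - real k) * - \<omega> w v"
      using k by (simp add: algebra_simps)
    moreover have "0 < (real n - real k) * - \<omega> w v" using h \<open>k < n\<close> by (intro mult_pos_pos) auto
    ultimately show False using h assms(4) by linarith
  qed
  then show ?thesis using k by simp
qed

lemma edge_points_mem:
  assumes "edge_points w e A n" "k \<le> n" shows "A + real k *\<^sub>R w \<in> e" "A + real k *\<^sub>R w \<in> L"
proof -
  have "A + real k *\<^sub>R w \<in> e \<inter> L" using assms unfolding edge_points_def by blast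
  then show "A + real k *\<^sub>R w \<in> e" "A + real k *\<^sub>R w \<in> L" by auto
qed

text \<open>Both directions pair to 1 with \<open>a\<close>, so they differ by some
  \<open>t a\<close>. Testing the second lattice point of each edge against the supporting line of
  the other gives \<open>t \<le> 0\<close> and \<open>t \<ge> 0\<close>.\<close>

lemma left_edge_unique:
  assumes e: "edge_data w 1 e" "a \<in> e" and e': "edge_data w' 1 e'" "a \<in> e'"
    and a: "prim a" "\<omega> u a = 0"
  shows "e' = e"
proof -
  have aL: "a \<in> L" "a \<noteq> 0" using a prim_nonzero by (auto simp: prim_def)
  have next_point: "a + w \<in> K L C" if e: "edge_data w 1 e" "a \<in> e" for w e
  proof -
    obtain A n where An: "edge_points w e A n" using edge_pointsE e by blast
    then have "a = A" using edge_points_first e aL a by blast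
    moreover have "n \<ge> 1" using An by (simp add: edge_points_def)
    ultimately have "a + w \<in> e" using edge_points_mem(1) [OF An, of 1] by simp
    then show ?thesis using e by (auto simp: edge_data_def)
  qed
  have aw: "\<omega> a w = 1" "\<omega> a w' = 1" using e e' by (auto simp: edge_data_def)
  then have "\<omega> (w' - w) a = 0" using anti [of w' a] anti [of w a] by simp
  then obtain t where "w' - w = t *\<^sub>R a" using parallel aL by blast
  then have t: "w' = w + t *\<^sub>R a" by (simp add: algebra_simps)
  have "1 \<le> \<omega> (a + w) w'" using next_point [OF e] e' by (auto simp: edge_data_def)
  then have "t \<le> 0" using aw anti [of w a] by (simp add: t)
  moreover have "1 \<le> \<omega> (a + w') w" using next_point [OF e'] e by (auto simp: edge_data_def)
  then have "t \<ge> 0" using aw by (simp add: t)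
  ultimately have "w' = w" using t by simp
  then show ?thesis using edge_data_unique e e' by blast
qed

text \<open>With a lattice point, an edge on level 0 contains all its positive integer
  multiples.\<close>

lemma edge_data_0_unbounded: "edge_data w 0 e \<Longrightarrow> \<not> bounded e"
proof
  assume e: "edge_data w 0 e" "bounded e"
  obtain A where A: "A \<in> L" "A \<in> e" using e by (auto simp: edge_data_def)
  then have AG: "A \<in> G" using e K_L_G by (auto simp: edge_data_def)
  obtain M where M: "\<And>x. x \<in> e \<Longrightarrow> norm x \<le> M" using e(2) bounded_iff by blast
  have "A \<noteq> 0" using AG by (simp add: G_def)
  then obtain k :: nat where k: "M < real k * norm A" using reals_Archimedean3 by (metis zero_less_norm_iff)
  have "real (Suc k) *\<^sub>R A \<in> G" using AG unfolding G_def by (auto intro!: C_scale L_scale)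
  then have "real (Suc k) *\<^sub>R A \<in> e" using A e G_K by (auto simp: edge_data_def)
  then have "real (Suc k) * norm A \<le> M" using M [of "real (Suc k) *\<^sub>R A"] by simp
  moreover have "real k * norm A \<le> real (Suc k) * norm A" by (intro mult_right_mono) auto
  ultimately show False using k by linarith
qed

lemma end_edge_eq:
  assumes a: "prim a" "\<omega> u a = 0" "0 < \<omega> a v" and e: "edge_data w 1 e" "a \<in> e"
  shows "end_edge L C ru = e"
proof -
  have aL: "a \<in> L" "a \<noteq> 0" using a prim_nonzero by (auto simp: prim_def)
  obtain A n where An: "edge_points w e A n" using edge_pointsE e by blast
  then have "a = A" using edge_points_first e aL a by blast
  define V where "V = a + real n *\<^sub>R w"
  have eV: "e = closed_segment a V" using An \<open>a = A\<close> by (simp add: edge_points_def V_def)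
  have "w \<noteq> 0" "n \<ge> 1" using An by (auto simp: edge_points_def)
  then have "V \<noteq> a" by (simp add: V_def)
  have "V extreme_point_of e" unfolding eV by (simp add: extreme_point_of_segment)
  then have Vv: "V \<in> vertices L C"
    using extreme_point_of_face [OF edge_data_face [OF e(1)]] by (simp add: vertices_def)
  have "end_vertex L C ru = V"
    unfolding end_vertex_def end_point_eq [OF a]
  proof (rule the_equality)
    show "V \<in> vertices L C \<and> V \<noteq> a \<and> closed_segment a V \<in> edges L C"
      using Vv \<open>V \<noteq> a\<close> edge_data_edge [OF e(1)] eV by simp
    fix V' assume V': "V' \<in> vertices L C \<and> V' \<noteq> a \<and> closed_segment a V' \<in> edges L C"
    then obtain w' d where w': "edge_data w' d (closed_segment a V')" using edge_cases by metis
    \<comment> \<open>Level 0 is excluded because a segment is bounded.\<close>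
    have "d = 1" using w' edge_data_0_unbounded bounded_closed_segment by (metis edge_data_def)
    then have "closed_segment a V' = e" using left_edge_unique [OF e _ _ a(1,2)] w' by simp
    then show "V' = V" using eV V' by (auto simp: closed_segment_eq doubleton_eq_iff)
  qed
  then show ?thesis by (simp add: end_edge_def end_point_eq [OF a] eV)
qed

lemma left_end:
  assumes "rational L ru"
  shows "\<exists>w. edge_data w 1 (end_edge L C ru)" "\<exists>A\<in>L. A \<in> end_edge L C ru \<and> \<omega> u A = 0"
    and "edge_data w' 1 e' \<Longrightarrow> A' \<in> L \<Longrightarrow> A' \<in> e' \<Longrightarrow> \<omega> u A' = 0 \<Longrightarrow> e' = end_edge L C ru"
proof -
  obtain a where a: "prim a" "\<omega> u a = 0" "0 < \<omega> a v" using rational_ruE assms by blast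
  obtain w e where e: "edge_data w 1 e" "a \<in> e" using left_edge_exists a by blast
  have ee: "end_edge L C ru = e" using end_edge_eq a e by blast
  show "\<exists>w. edge_data w 1 (end_edge L C ru)" using e ee by blast
  show "\<exists>A\<in>L. A \<in> end_edge L C ru \<and> \<omega> u A = 0" using e ee a unfolding prim_def by blast
  assume e': "edge_data w' 1 e'" "A' \<in> L" "A' \<in> e'" "\<omega> u A' = 0"
  have "A' \<in> G" using e' K_L_G by (auto simp: edge_data_def)
  then have A': "A' \<noteq> 0" "0 \<le> \<omega> A' v" by (auto simp: G_def C_def)
  obtain t where t: "A' = t *\<^sub>R a" "t \<ge> 1" using ru_multiple a e' A' by metis
  have "w' \<in> L" "\<omega> A' w' = 1" using e' by (auto simp: edge_data_def prim_def)
  \<comment> \<open>Pairing to 1 with \<open>w'\<close> makes \<open>A'\<close> primitive, so it is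
    the first lattice point \<open>a\<close> of the ray.\<close>
  then have "prim A'" using e'(2) anti [of w' A'] unfolding prim_def by (auto intro!: bexI [of _ "- w'"])
  then have "A' = a" using prim_pos_multiple_eq [OF a(1)] t by simp
  then show "e' = end_edge L C ru" using left_edge_unique [OF e _ _ a(1,2)] e' ee by blast
qed

text \<open>Reversing the orientation negates the direction, and the two lattice points of the edge
  exchange their roles.\<close>

lemma swap_edge_data: "lattice_cone.edge_data L (\<lambda>x y. - \<omega> x y) v u w d e \<longleftrightarrow> edge_data (- w) d e"
proof -
  interpret s: lattice_cone L "\<lambda>x y. - \<omega> x y" c b v u by (rule swap)
  have "s.prim w \<longleftrightarrow> prim (- w)" by (auto simp: s.prim_def prim_def)
  moreover have "w \<in> s.C' \<longleftrightarrow> - w \<in> C'" by (auto simp: s.C'_def C'_def)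
  moreover have "\<exists>A\<in>L. A \<in> e \<and> A + - x \<in> e" if x: "x \<in> L" "\<exists>A\<in>L. A \<in> e \<and> A + x \<in> e" for x
  proof -
    obtain A where "A \<in> L" "A \<in> e" "A + x \<in> e" using x by blast
    then show ?thesis using x(1) L_add by (intro bexI [of _ "A + x"]) auto
  qed
  from this [of w] this [of "- w"] have "w \<in> L \<Longrightarrow> (\<exists>A\<in>L. A \<in> e \<and> A + w \<in> e) \<longleftrightarrow> (\<exists>A\<in>L. A \<in> e \<and> A + - w \<in> e)"
    by auto
  then have "prim (- w) \<Longrightarrow> (\<exists>A\<in>L. A \<in> e \<and> A + w \<in> e) \<longleftrightarrow> (\<exists>A\<in>L. A \<in> e \<and> A + - w \<in> e)"
    by (simp add: prim_def)
  ultimately show ?thesis unfolding s.edge_data_def edge_data_def swap_C by auto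
qed

lemma right_end:
  assumes "rational L rv"
  shows "\<exists>w. edge_data w 1 (end_edge L C rv)" "\<exists>A\<in>L. A \<in> end_edge L C rv \<and> \<omega> A v = 0"
    and "edge_data w' 1 e' \<Longrightarrow> A' \<in> L \<Longrightarrow> A' \<in> e' \<Longrightarrow> \<omega> A' v = 0 \<Longrightarrow> e' = end_edge L C rv"
proof -
  interpret s: lattice_cone L "\<lambda>x y. - \<omega> x y" c b v u by (rule swap)
  note s_end = s.left_end [OF assms, unfolded swap_C swap_edge_data]
  show "\<exists>w. edge_data w 1 (end_edge L C rv)" using s_end(1) by blast
  show "\<exists>A\<in>L. A \<in> end_edge L C rv \<and> \<omega> A v = 0" using s_end(2) anti [of v] by auto
  assume "edge_data w' 1 e'" "A' \<in> L" "A' \<in> e'" "\<omega> A' v = 0"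
  then show "e' = end_edge L C rv" using s_end(3) [of "- w'" e' A'] anti [of v A'] by simp
qed

section \<open>The map from edges to lattice points\<close>

lemma edge_points_facts:
  assumes "edge_points w e A n"
  shows "n \<ge> 1" "A \<in> L" "\<omega> A w = 1" "w \<in> L" "0 < \<omega> u w" "\<omega> w v < 0"
    "0 \<le> \<omega> u A" "\<omega> u (A - w) < 0" "0 \<le> \<omega> (A + real n *\<^sub>R w) v"
    "\<omega> (A + real (Suc n) *\<^sub>R w) v < 0"
  using assms unfolding edge_points_def by blast+

lemma edge_points_vertexI:
  assumes e: "edge_points w e A n" and "k < n"
    and "0 < k \<or> 0 < \<omega> u A" "Suc k < n \<or> Suc k = n \<and> 0 < \<omega> (A + real n *\<^sub>R w) v"
  shows "w \<in> vertices L C'"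
proof (rule dual_vertexI)
  note f = edge_points_facts [OF e]
  show "w \<in> C'" using f anti [of v w] by (simp add: C'_def)
  show "w \<in> L" by (rule f)
  show "A + real k *\<^sub>R w \<in> L" using f by (auto intro!: L_add L_scale)
  show "A + real k *\<^sub>R w \<in> Ci" using assms by (intro edge_points_Ci [OF e]) auto
  have "A + real k *\<^sub>R w + w = A + real (Suc k) *\<^sub>R w" by (simp add: algebra_simps)
  moreover have "A + real (Suc k) *\<^sub>R w \<in> Ci" using assms by (intro edge_points_Ci [OF e]) auto
  ultimately show "A + real k *\<^sub>R w + w \<in> Ci" by (simp only:)
  show "\<omega> (A + real k *\<^sub>R w) w = 1" using f by simp
qed

lemma om_left_nonzero: "\<omega> x y = 1 \<or> \<omega> x y = - 1 \<Longrightarrow> x \<noteq> 0"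
  by auto

text \<open>\<open>- A\<close> lies on the edge of the supplementary cone opposite to
  \<open>u\<close>, and \<open>A + 2 w\<close> has left the cone across \<open>v\<close>. Both are
  in \<open>C'\<close>, and \<open>w\<close> is their midpoint.\<close>

lemma left_edge_not_vertex:
  assumes e: "edge_points w e A 1" and A0: "\<omega> u A = 0"
  shows "w \<notin> vertices L C'"
proof (rule dual_not_vertexI)
  note f = edge_points_facts [OF e]
  let ?B = "A + 2 *\<^sub>R w"
  have o: "\<omega> A w = 1" "\<omega> ?B w = 1" "\<omega> (- A) w = - 1" using f by simp_all
  have Av: "0 \<le> \<omega> A v" using f(6,9) by simp
  have Bv: "\<omega> ?B v < 0" using f(10) by simp
  have "?B \<noteq> 0" "- A \<noteq> 0" using o(2,3) om_left_nonzero by blast+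
  show "?B \<in> G'" unfolding G'_def C'_def
    using Bv f A0 anti [of v ?B] \<open>?B \<noteq> 0\<close> by (auto intro!: L_add L_scale simp del: om_simps(3)) 
  show "- A \<in> G'" unfolding G'_def C'_def
    using Av f A0 anti [of v A] \<open>- A \<noteq> 0\<close> by auto
  show "?B \<noteq> - A"
  proof
    assume eq: "?B = - A"
    show False using o(2,3) unfolding eq by simp
  qed
  show "?B + - A = 2 *\<^sub>R w" by simp
qed

text \<open>Mirror image: \<open>w\<close> is the midpoint of \<open>A + w\<close>, which lies on
  the ray of \<open>v\<close>, and \<open>w - A\<close>.\<close>

lemma right_edge_not_vertex:
  assumes e: "edge_points w e A 1" and A0: "\<omega> (A + w) v = 0"
  shows "w \<notin> vertices L C'"
proof (rule dual_not_vertexI)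
  note f = edge_points_facts [OF e]
  have o: "\<omega> (A + w) w = 1" "\<omega> (w - A) w = - 1" using f by simp_all
  then have nz: "A + w \<noteq> 0" "w - A \<noteq> 0" using om_left_nonzero by blast+
  have av: "\<omega> (w - A) v < 0" using A0 f by simp
  show "A + w \<in> G'" unfolding G'_def C'_def
    using A0 f anti [of v "A + w"] nz by (auto intro!: L_add)
  show "w - A \<in> G'" unfolding G'_def C'_def
    using av f anti [of v "w - A"] nz by (auto intro!: L_diff)
  show "A + w \<noteq> w - A" using arg_cong [of "A + w" "w - A" "\<lambda>x. \<omega> x w"] o by auto
  show "A + w + (w - A) = 2 *\<^sub>R w" by (simp add: scaleR_2)
qed

text \<open>For \<open>n \<ge> 2\<close> the interior pair is \<open>A + w\<close>,
  \<open>A + 2 w\<close>. If \<open>n = 2\<close>, the second is the last point of the edge, and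
  \<open>ex\<close> keeps it off the ray of \<open>v\<close>.\<close>

lemma left_criterion:
  assumes e: "edge_points w e A n" and A0: "\<omega> u A = 0"
    and ex: "\<not> (n = 2 \<and> \<omega> (A + real n *\<^sub>R w) v = 0)"
  shows "w \<in> vertices L C' \<longleftrightarrow> n \<ge> 2"
proof
  assume "w \<in> vertices L C'"
  then have "n \<noteq> 1" using left_edge_not_vertex e A0 by blast
  then show "n \<ge> 2" using edge_points_facts(1) [OF e] by simp
next
  assume "n \<ge> 2"
  moreover have "0 < \<omega> (A + real n *\<^sub>R w) v" if "n = 2"
    using that ex edge_points_facts(9) [OF e] by linarith
  ultimately have "Suc 1 < n \<or> Suc 1 = n \<and> 0 < \<omega> (A + real n *\<^sub>R w) v" by (cases "n = 2") linarith+
  then show "w \<in> vertices L C'"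
    by (intro edge_points_vertexI [OF e, of 1]) linarith+
qed

text \<open>Here the interior pair is \<open>A + (n - 2) w\<close>, \<open>A + (n - 1) w\<close>;
  for \<open>n = 2\<close> it starts at \<open>A\<close>, which \<open>ex\<close> keeps off the ray
  of \<open>u\<close>.\<close>

lemma right_criterion:
  assumes e: "edge_points w e A n" and A0: "\<omega> (A + real n *\<^sub>R w) v = 0"
    and ex: "\<not> (n = 2 \<and> \<omega> u A = 0)"
  shows "w \<in> vertices L C' \<longleftrightarrow> n \<ge> 2"
proof
  assume "w \<in> vertices L C'"
  then have "n \<noteq> 1" using right_edge_not_vertex [of w e A] e A0 by auto
  then show "n \<ge> 2" using edge_points_facts(1) [OF e] by simp
next
  assume "n \<ge> 2"
  moreover have "0 < \<omega> u A" if "n = 2"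
    using that ex edge_points_facts(7) [OF e] by linarith
  ultimately have "0 < n - 2 \<or> 0 < \<omega> u A" by (cases "n = 2") linarith+
  then show "w \<in> vertices L C'"
    using \<open>n \<ge> 2\<close> by (intro edge_points_vertexI [OF e, of "n - 2"]) linarith+
qed

lemma vertex_P': "w \<in> vertices L C' \<Longrightarrow> w \<in> P L C'"
proof -
  assume w: "w \<in> vertices L C'"
  then have ext: "w extreme_point_of K L C'" by (simp add: vertices_def)
  then have "w \<in> K L C'" by (simp add: extreme_point_of_def)
  have "2 *\<^sub>R w \<in> K L C'" using dual_vertex_G' [OF w] by (intro G'_K') (auto simp: G'_def C'_def intro: L_scale)
  moreover have "w \<noteq> 2 *\<^sub>R w" using dual_vertex_G' [OF w] by (auto simp: G'_def scaleR_2)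
  ultimately have "{w} \<noteq> K L C'" by (metis singletonD)
  moreover have "{w} face_of K L C'" using ext by (simp add: face_of_singleton)
  ultimately have "w \<notin> interior (K L C')" using face_of_disjoint_interior by blast
  then show "w \<in> P L C'" using \<open>w \<in> K L C'\<close> closure_subset by (auto simp: P_def frontier_def)
qed

text \<open>One interior lattice point \<open>M\<close> gives the supporting line
  \<open>\<omega> M p = 1\<close>, which is enough for the boundary; \<open>dual_vertexI\<close>
  takes two such lines.\<close>

lemma touching_P':
  assumes M: "M \<in> Ci" "M \<in> L" and w: "w \<in> G'" "\<omega> M w = 1" shows "w \<in> P L C'"
proof -
  interpret d: lattice_cone L "\<lambda>x y. - \<omega> x y" c b "- u" v by (rule dual)
  let ?F = "{p \<in> K L C'. \<omega> M p = 1}"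
  have "1 \<le> - \<omega> p M" if "p \<in> K L C'" for p using om_Ci_K'_ge_1 [OF M that] anti [of p M] by simp
  then have "{p \<in> K L C'. - \<omega> p M = 1} face_of K L C'"
    using d.face_line [of 1 M] by (simp add: dual_C)
  then have F: "?F face_of K L C'" using anti [of _ M] by simp
  have "2 *\<^sub>R w \<in> K L C'" using w by (intro G'_K') (auto simp: G'_def C'_def intro: L_scale)
  moreover have "2 *\<^sub>R w \<notin> ?F" using w by simp
  ultimately have "?F \<noteq> K L C'" by blast
  then have "?F \<inter> interior (K L C') = {}" using face_of_disjoint_interior [OF F] by blast
  moreover have "w \<in> ?F" using w G'_K' by simp
  ultimately show ?thesis using closure_subset by (auto simp: P_def frontier_def)
qed

lemma end_edges_eq:
  assumes e: "edge_data w 1 e" "edge_points w e A n"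
  shows "\<omega> u A = 0 \<Longrightarrow> rational L ru \<and> e = end_edge L C ru"
    and "\<omega> (A + real n *\<^sub>R w) v = 0 \<Longrightarrow> rational L rv \<and> e = end_edge L C rv"
proof -
  have mem: "A \<in> e" "A \<in> L" "A + real n *\<^sub>R w \<in> e" "A + real n *\<^sub>R w \<in> L"
    using edge_points_mem [OF e(2), of 0] edge_points_mem [OF e(2), of n] by auto
  then have G: "A \<in> G" "A + real n *\<^sub>R w \<in> G" using e(1) K_L_G by (auto simp: edge_data_def)
  show "rational L ru \<and> e = end_edge L C ru" if "\<omega> u A = 0"
  proof -
    have "rational L ru" by (rule rational_ruI [of A]) (use G that in \<open>auto simp: G_def C_def\<close>)
    then show ?thesis using left_end(3) [OF _ e(1)] mem that by blast
  qed
  show "rational L rv \<and> e = end_edge L C rv" if "\<omega> (A + real n *\<^sub>R w) v = 0"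
  proof -
    have "rational L rv"
      by (rule rational_rvI [of "A + real n *\<^sub>R w"]) (use G that in \<open>auto simp: G_def C_def simp del: om_simps\<close>)
    then show ?thesis using right_end(3) [OF _ e(1)] mem that by blast
  qed
qed

lemma edge_single:
  assumes e: "edge_data w 1 e" "edge_points w e A n"
    and "\<omega> u A = 0" "\<omega> (A + real n *\<^sub>R w) v = 0"
  shows "single_edge L ru rv n"
proof -
  have "rational L ru" "e = end_edge L C ru" "rational L rv" "e = end_edge L C rv"
    using end_edges_eq [OF e] assms by auto
  then show ?thesis
    using edge_points_int_length [OF e(2)] unfolding single_edge_def angle_eq by metis
qed

lemma left_end_points:
  assumes "rational L ru"
  obtains w A n where "edge_data w 1 (end_edge L C ru)" "edge_points w (end_edge L C ru) A n" "\<omega> u A = 0"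
proof -
  obtain w where w: "edge_data w 1 (end_edge L C ru)" using left_end(1) assms by blast
  obtain A n where An: "edge_points w (end_edge L C ru) A n" using edge_pointsE w by blast
  obtain x where x: "x \<in> L" "x \<in> end_edge L C ru" "\<omega> u x = 0" using left_end(2) assms by blast
  then have "x = A" using edge_points_first An by blast
  then show ?thesis using that w An x by blast
qed

lemma right_end_points:
  assumes "rational L rv"
  obtains w A n where "edge_data w 1 (end_edge L C rv)" "edge_points w (end_edge L C rv) A n"
    "\<omega> (A + real n *\<^sub>R w) v = 0"
proof -
  obtain w where w: "edge_data w 1 (end_edge L C rv)" using right_end(1) assms by blast
  obtain A n where An: "edge_points w (end_edge L C rv) A n" using edge_pointsE w by blast
  obtain x where x: "x \<in> L" "x \<in> end_edge L C rv" "\<omega> x v = 0" using right_end(2) assms by blast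
  then have "x = A + real n *\<^sub>R w" using edge_points_last An by blast
  then show ?thesis using that w An x by blast
qed

abbreviation I where "I \<equiv> edge_vector L ru rv"

lemma I_edge_data:
  assumes "e \<in> edges L C" shows "\<exists>d. edge_data (I e) d e"
proof -
  obtain w d where "edge_data w d e" using edge_cases assms by blast
  then show ?thesis using edge_vector_eq by auto
qed

lemma I_mem: "e \<in> edges L C \<Longrightarrow> I e \<in> C' \<inter> L"
  using I_edge_data [of e] by (auto simp: edge_data_def prim_def)

lemma I_G': "e \<in> edges L C \<Longrightarrow> I e \<in> G'"
  using I_mem [of e] I_edge_data [of e] prim_nonzero [of "I e"] by (auto simp: edge_data_def G'_def)

lemma vertices_subset_I: "vertices L C' \<subseteq> I ` edges L C"
proof
  fix w assume "w \<in> vertices L C'"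
  then obtain d e where e: "edge_data w d e" using dual_vertex_edge by blast
  then show "w \<in> I ` edges L C" using edge_vector_eq [OF e] edge_data_edge [OF e] by blast
qed

lemma I_P':
  assumes "\<not> single_edge L ru rv 1" "e \<in> edges L C" shows "I e \<in> P L C'"
proof -
  obtain d where d: "edge_data (I e) d e" using I_edge_data assms by blast
  have "d = 0 \<or> d = 1" using d by (auto simp: edge_data_def)
  then show ?thesis
  proof
    assume "d = 0"
    then show ?thesis using edge_data_0_vertex vertex_P' d by blast
  next
    assume "d = 1"
    then have e1: "edge_data (I e) 1 e" using d by simp
    then obtain A n where An: "edge_points (I e) e A n" using edge_pointsE by blast
    note f = edge_points_facts [OF An]
    have "\<not> (n = 1 \<and> \<omega> u A = 0 \<and> \<omega> (A + real n *\<^sub>R I e) v = 0)"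
      using edge_single [OF e1 An] assms by auto
    \<comment> \<open>An edge has a lattice point interior to the cone unless it has just two
      lattice points, one on each ray.\<close>
    then have "\<exists>k\<le>n. (0 < k \<or> 0 < \<omega> u A) \<and> (k < n \<or> k = n \<and> 0 < \<omega> (A + real n *\<^sub>R I e) v)"
    proof -
      consider "n \<ge> 2" | "0 < \<omega> u A" | "n = 1" "0 < \<omega> (A + real n *\<^sub>R I e) v"
        using \<open>\<not> (n = 1 \<and> \<omega> u A = 0 \<and> \<omega> (A + real n *\<^sub>R I e) v = 0)\<close> f(1,7,9) by linarith
      then show ?thesis
      proof cases
        case 1 then show ?thesis by (intro exI [of _ 1]) auto
      next
        case 2 then show ?thesis using f(1) by (intro exI [of _ 0]) auto
      next
        case 3 then show ?thesis by (intro exI [of _ 1]) auto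
      qed
    qed
    then obtain k where k: "k \<le> n" "A + real k *\<^sub>R I e \<in> Ci" using edge_points_Ci [OF An] by blast
    show ?thesis
    proof (rule touching_P' [OF k(2)])
      show "A + real k *\<^sub>R I e \<in> L" using edge_points_mem [OF An k(1)] by blast
      show "I e \<in> G'" using I_G' assms by blast
      show "\<omega> (A + real k *\<^sub>R I e) (I e) = 1" using f by simp
    qed
  qed
qed

text \<open>The sign of \<open>\<omega> (I e) (I e')\<close> decides both orders; asymmetry of the
  orders turns the implications into an equivalence.\<close>

lemma I_order:
  assumes ns: "\<not> single_edge L ru rv 1" and e: "e \<in> edges L C" "e' \<in> edges L C"
  shows "edge_before L ru rv e e' \<longleftrightarrow> before L {t *\<^sub>R (- u) | t. 0 \<le> t} rv (I e) (I e')"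
proof -
  interpret d: lattice_cone L "\<lambda>x y. - \<omega> x y" c b "- u" v by (rule dual)
  \<comment> \<open>The supplementary cone carries the form \<open>- \<omega>\<close>, hence the
    negative sign.\<close>
  have before': "before L d.ru rv p q"
    if "p \<in> P L C'" "q \<in> P L C'" "\<omega> p q < 0" for p q
    using that d.g_less_if_om_pos [of p q] unfolding d.before_iff dual_C by simp
  have asym': "\<not> (before L d.ru rv p q \<and> before L d.ru rv q p)" for p q
    unfolding d.before_iff by linarith
  have asym: "\<not> (edge_before L ru rv e e' \<and> edge_before L ru rv e' e)" if "e \<in> edges L C" "e' \<in> edges L C" for e e'
  proof
    assume b: "edge_before L ru rv e e' \<and> edge_before L ru rv e' e"
    then have ne: "e \<noteq> e'" by (simp add: edge_before_def)
    have "A = B" if "A \<in> e" "B \<in> e'" for A B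
      using b that unfolding edge_before_def before_iff by (metis less_asym)
    moreover obtain A w where "A \<in> e" "A + w \<in> e" "prim w" using edge_two_points \<open>e \<in> edges L C\<close> by metis
    moreover obtain B where "B \<in> e'" using edge_two_points \<open>e' \<in> edges L C\<close> by metis
    ultimately have "A + w = A" by metis
    then show False using prim_nonzero \<open>prim w\<close> by simp
  qed
  obtain k k' where k: "edge_data (I e) k e" "edge_data (I e') k' e'" using I_edge_data e by blast
  have P': "I e \<in> P L C'" "I e' \<in> P L C'" using I_P' ns e by auto
  show ?thesis
  proof (cases "e = e'")
    case True
    then show ?thesis using asym' by (auto simp: edge_before_def)
  next
    case False
    then consider "\<omega> (I e) (I e') < 0" | "\<omega> (I e') (I e) < 0"
      using edge_data_not_parallel [OF k] anti [of "I e'" "I e"] by linarith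
    then show ?thesis
    proof cases
      case 1
      then show ?thesis using edge_beforeI [OF k] before' P' by blast
    next
      case 2
      then show ?thesis using edge_beforeI [OF k(2,1)] before' [OF P'(2,1)] asym [OF e] asym' by blast
    qed
  qed
qed

lemma I_not_vertex:
  assumes "e \<in> edges L C" "I e \<notin> vertices L C'"
  shows "rational L ru \<and> e = end_edge L C ru \<or> rational L rv \<and> e = end_edge L C rv"
proof -
  obtain d where d: "edge_data (I e) d e" using I_edge_data assms by blast
  have "d \<noteq> 0" using edge_data_0_vertex d assms by blast
  then have e1: "edge_data (I e) 1 e" using d by (auto simp: edge_data_def)
  then obtain A n where An: "edge_points (I e) e A n" using edge_pointsE by blast
  note f = edge_points_facts [OF An]
  have "\<omega> u A = 0 \<or> \<omega> (A + real n *\<^sub>R I e) v = 0"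
  proof (rule ccontr)
    assume "\<not> ?thesis"
    then have "0 < \<omega> u A" "0 < \<omega> (A + real n *\<^sub>R I e) v" using f(7,9) by linarith+
    \<comment> \<open>With both ends off the rays, the first two lattice points of the edge are
      interior.\<close>
    then have "I e \<in> vertices L C'" using f(1) by (intro edge_points_vertexI [OF An, of 0]) (auto simp del: om_simps)
    then show False using assms by simp
  qed
  then show ?thesis using end_edges_eq [OF e1 An] by blast
qed

lemma left_end_vertex_iff:
  assumes "rational L ru" "\<not> single_edge L ru rv 2"
  shows "I (end_edge L C ru) \<in> vertices L C' \<longleftrightarrow> 2 \<le> int_length L (end_edge L C ru)"
proof -
  obtain w A n where w: "edge_data w 1 (end_edge L C ru)" "edge_points w (end_edge L C ru) A n" "\<omega> u A = 0"
    using left_end_points assms by blast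
  have "\<not> (n = 2 \<and> \<omega> (A + real n *\<^sub>R w) v = 0)" using edge_single [OF w] assms by auto
  then show ?thesis
    using left_criterion [OF w(2,3)] edge_points_int_length [OF w(2)] edge_vector_eq [OF w(1)] by simp
qed

lemma right_end_vertex_iff:
  assumes "rational L rv" "\<not> single_edge L ru rv 2"
  shows "I (end_edge L C rv) \<in> vertices L C' \<longleftrightarrow> 2 \<le> int_length L (end_edge L C rv)"
proof -
  obtain w A n where w: "edge_data w 1 (end_edge L C rv)" "edge_points w (end_edge L C rv) A n"
    "\<omega> (A + real n *\<^sub>R w) v = 0" using right_end_points assms by blast
  have "\<not> (n = 2 \<and> \<omega> u A = 0)" using edge_single [OF w(1,2) _ w(3)] assms by auto
  then show ?thesis
    using right_criterion [OF w(2,3)] edge_points_int_length [OF w(2)] edge_vector_eq [OF w(1)] by simp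
qed

lemma end_edges_mem:
  "rational L ru \<Longrightarrow> end_edge L C ru \<in> edges L C" "rational L rv \<Longrightarrow> end_edge L C rv \<in> edges L C"
  using left_end(1) right_end(1) edge_data_edge by blast+

lemma vertices_eq_iff:
  assumes "\<not> single_edge L ru rv 2"
  shows "vertices L C' = I ` edges L C \<longleftrightarrow>
     (rational L ru \<longrightarrow> 2 \<le> int_length L (end_edge L C ru)) \<and>
     (rational L rv \<longrightarrow> 2 \<le> int_length L (end_edge L C rv))"
proof
  assume "vertices L C' = I ` edges L C"
  then show "(rational L ru \<longrightarrow> 2 \<le> int_length L (end_edge L C ru)) \<and>
     (rational L rv \<longrightarrow> 2 \<le> int_length L (end_edge L C rv))"
    using left_end_vertex_iff right_end_vertex_iff assms end_edges_mem by blast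
next
  assume "(rational L ru \<longrightarrow> 2 \<le> int_length L (end_edge L C ru)) \<and>
     (rational L rv \<longrightarrow> 2 \<le> int_length L (end_edge L C rv))"
  then have "I e \<in> vertices L C'" if "e \<in> edges L C" for e
    using left_end_vertex_iff right_end_vertex_iff assms I_not_vertex that by blast
  then show "vertices L C' = I ` edges L C" using vertices_subset_I by blast
qed

lemma opposite_ru: "opposite ru = {t *\<^sub>R (- u) | t. 0 \<le> t}"
  unfolding opposite_def by (force simp: image_iff)

lemma dual_angle: "angle {t *\<^sub>R (- u) | t. 0 \<le> t} rv = C'"
proof -
  interpret d: lattice_cone L "\<lambda>x y. - \<omega> x y" c b "- u" v by (rule dual)
  show ?thesis using d.angle_eq dual_C by simp
qed

end

section \<open>From a planar lattice to a unimodular form, and the theorem\<close>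

lemma planar_lattice_form:
  fixes L :: "'a::euclidean_space set"
  assumes "planar_lattice L" obtains \<omega> b c where "unimodular_plane L \<omega> b c"
proof -
  obtain b c where bc: "b \<noteq> c" "independent {b, c}"
    and L: "L = {of_int m *\<^sub>R b + of_int n *\<^sub>R c | m n. True}" and dim: "DIM('a) = 2"
    using assms unfolding planar_lattice_def by blast
  have "span {b, c} = UNIV"
    using card_eq_dim [of "{b, c}" UNIV] bc dim by (auto simp: card_insert_if)
  define X where "X x = representation {b, c} x b" for x
  define Y where "Y x = representation {b, c} x c" for x
  have lin: "linear X" "linear Y"
    unfolding X_def [abs_def] Y_def [abs_def]
    by (rule linearI; simp add: representation_add representation_scale bc \<open>span {b, c} = UNIV\<close>)+
  have ex: "X x *\<^sub>R b + Y x *\<^sub>R c = x" for x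
    using sum_representation_eq [OF bc(2), of x "{b, c}"] \<open>span {b, c} = UNIV\<close> bc(1)
    by (simp add: X_def Y_def)
  have b: "X b = 1" "Y b = 0" "X c = 0" "Y c = 1"
    using bc by (simp_all add: X_def Y_def representation_basis)
  have "unimodular_plane L (\<lambda>x y. X x * Y y - Y x * X y) b c"
  proof (rule unimodular_plane.intro)
    show "bounded_bilinear (\<lambda>x y. X x * Y y - Y x * X y)"
      unfolding bilinear_conv_bounded_bilinear [symmetric] bilinear_def
      by (auto intro!: linearI simp: linear_add [OF lin(1)] linear_add [OF lin(2)]
          linear_scale [OF lin(1)] linear_scale [OF lin(2)] algebra_simps)
  qed (use b ex L dim in auto)
  then show ?thesis using that by blast
qed

theorem proposition5p3:
  fixes L lm lp :: "'a::euclidean_space set"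
  assumes "planar_lattice L"
    and "half_line lm" and "half_line lp"
    and "lp \<noteq> lm" and "lp \<noteq> opposite lm"
  shows
    "let \<sigma> = angle lm lp;
         lm' = opposite lm;
         \<sigma>' = angle lm' lp;
         I = edge_vector L lm lp;
         em = end_edge L \<sigma> lm;
         ep = end_edge L \<sigma> lp
     in
       \<comment> \<open>(i)\<close>
       (I \<in> edges L \<sigma> \<rightarrow> \<sigma>' \<inter> L \<and>
        vertices L \<sigma>' \<subseteq> I ` edges L \<sigma> \<and>
        (\<not> single_edge L lm lp 1 \<longrightarrow>
           I ` edges L \<sigma> \<subseteq> P L \<sigma>' \<inter> L \<and>
           (\<forall>e\<in>edges L \<sigma>. \<forall>e'\<in>edges L \<sigma>.
              edge_before L lm lp e e' \<longleftrightarrow> before L lm' lp (I e) (I e')))) \<and>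
       \<comment> \<open>(ii)\<close>
       (I ` edges L \<sigma> - vertices L \<sigma>' \<subseteq>
          (if rational L lm then {I em} else {}) \<union> (if rational L lp then {I ep} else {}) \<and>
        (\<not> single_edge L lm lp 2 \<longrightarrow>
           (rational L lm \<longrightarrow> (I em \<in> vertices L \<sigma>' \<longleftrightarrow> int_length L em \<ge> 2)) \<and>
           (rational L lp \<longrightarrow> (I ep \<in> vertices L \<sigma>' \<longleftrightarrow> int_length L ep \<ge> 2)))) \<and>
       \<comment> \<open>(iii)\<close>
       (\<not> single_edge L lm lp 2 \<longrightarrow>
          (vertices L \<sigma>' = I ` edges L \<sigma> \<longleftrightarrow>
             (rational L lm \<longrightarrow> int_length L em \<ge> 2) \<and>
             (rational L lp \<longrightarrow> int_length L ep \<ge> 2)))"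
proof -
  obtain \<omega>0 b0 c0 where "unimodular_plane L \<omega>0 b0 c0" using planar_lattice_form assms(1) by blast
  then interpret p: unimodular_plane L \<omega>0 b0 c0 .
  obtain u where u: "u \<noteq> 0" and lm: "lm = {t *\<^sub>R u | t. 0 \<le> t}" using assms(2) unfolding half_line_def by blast
  obtain v where v: "v \<noteq> 0" and lp: "lp = {t *\<^sub>R v | t. 0 \<le> t}" using assms(3) unfolding half_line_def by blast
  \<comment> \<open>Proportional generators would make the half-lines equal or opposite.\<close>
  have "\<omega>0 u v \<noteq> 0"
  proof
    assume "\<omega>0 u v = 0"
    then obtain k where k: "u = k *\<^sub>R v" using p.parallel v by blast
    have ray: "{t *\<^sub>R (s *\<^sub>R v) | t. 0 \<le> t} = {t *\<^sub>R v | t. 0 \<le> t}" if s: "s > 0" for s :: real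
    proof (intro subset_antisym subsetI)
      fix x assume "x \<in> {t *\<^sub>R v | t. 0 \<le> t}"
      then obtain t where "x = t *\<^sub>R v" "0 \<le> t" by blast
      then have "x = (t / s) *\<^sub>R (s *\<^sub>R v)" "0 \<le> t / s" using s by auto
      then show "x \<in> {t *\<^sub>R (s *\<^sub>R v) | t. 0 \<le> t}" by blast
    next
      fix x assume "x \<in> {t *\<^sub>R (s *\<^sub>R v) | t. 0 \<le> t}"
      then obtain t where "x = t *\<^sub>R (s *\<^sub>R v)" "0 \<le> t" by blast
      then have "x = (t * s) *\<^sub>R v" "0 \<le> t * s" using s by auto
      then show "x \<in> {t *\<^sub>R v | t. 0 \<le> t}" by blast
    qed
    have "k \<noteq> 0" using k u by auto
    then consider "k > 0" | "- k > 0" by linarith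
    then show False
    proof cases
      case 1
      then show False using ray [of k] k lm lp assms(4) by simp
    next
      case 2
      have "opposite lm = {t *\<^sub>R ((- k) *\<^sub>R v) | t. 0 \<le> t}"
        unfolding opposite_def lm k by (force simp: image_iff)
      then show False using ray [OF 2] lp assms(5) by simp
    qed
  qed
  \<comment> \<open>The sign of the form is adapted to the ordered pair \<open>u\<close>,
    \<open>v\<close>, so no orientation of the plane has to be fixed beforehand.\<close>
  then obtain \<omega> b c where "lattice_cone L \<omega> b c u v"
  proof (cases "0 < \<omega>0 u v")
    case True
    then show ?thesis using that p.unimodular_plane_axioms
      by (blast intro: lattice_cone.intro lattice_cone_axioms.intro)
  next
    case False
    then have "0 < - \<omega>0 u v" using \<open>\<omega>0 u v \<noteq> 0\<close> by simp
    then show ?thesis using that [OF lattice_cone.intro [OF p.opposite_form lattice_cone_axioms.intro]] by blast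
  qed
  then interpret lattice_cone L \<omega> b c u v .
  have "I ` edges L C - vertices L C' \<subseteq> (if rational L ru then {I (end_edge L C ru)} else {}) \<union>
      (if rational L rv then {I (end_edge L C rv)} else {})"
    using I_not_vertex by auto
  moreover have "I ` edges L C \<subseteq> P L C' \<inter> L" if "\<not> single_edge L ru rv 1"
    using I_P' [OF that] I_mem by blast
  moreover have "I \<in> edges L C \<rightarrow> C' \<inter> L" using I_mem by (rule Pi_I)
  ultimately show ?thesis
    unfolding Let_def lm lp opposite_ru angle_eq dual_angle
    by (intro conjI impI ballI vertices_subset_I I_order left_end_vertex_iff right_end_vertex_iff
        vertices_eq_iff) simp_all
qed

end
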